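(* Let $\bar V_2\le \bar W_2:\mathcal X\times\mathcal X\to[1,\infty)$ be symmetric measurable functions such that $P$ satisfies $C(2,\bar V_2,\bar W_2)$, and such that $P^s\bar W_2(x,y)<\infty$ for all $(x,y)\in\mathcal X^2$ and $s\in\{1,2\}$. Let $\{h_n:\mathcal X\times\mathcal X\to\mathbb R,\ n\ge1\}$ be symmetric measurable functions with $\int\int|h_n|\,d\mu\,d\mu<\infty$ and $\bar h_{n,2}\in\mathcal L_{\bar V_2}$ for each $n\ge1$, and let $w_n:\mathbb N\times\mathbb N\to\mathbb R$ be weights (where $0\in\mathbb N$). Let $U_n(h_n)=\sum_{\ell=1}^n\sum_{j=1}^\ell w_n(\ell,j)h_n(X_\ell,X_j)$. Then $$U_n(h_n)=U_{n,0}+\sum_{\ell=1}^n\Big\{w_{n,1}(\ell)\bar h_{n,1}(X_\ell)+w_n(\ell,\ell)Q_{n,\ell,\ell}\Big\}+\sum_{\ell=1}^n\sum_{j=1}^{\ell-1}w_n(\ell,j)Q_{n,\ell,j}+\zeta_n,$$ where $U_{n,0}=\theta_n\sum_{\ell=1}^n\sum_{j=1}^\ell w_n(\ell,j)$ and $$\begin{aligned}\zeta_n=&\sum_{\ell=1}^n\sum_{j=1}^\ell\varpi_{n,1}(\ell,j)\big(P\bar G_{n,2}(X_{\ell-1},X_j)-P^2\bar G_{n,2}(X_{\ell-1},X_{j-1})\big)\\&+\sum_{\ell=1}^n\sum_{j=1}^\ell\varpi_{n,2}(\ell,j)\big(P\bar G_{n,2}(X_{j-1},X_\ell)-P^2\bar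 G_{n,2}(X_{\ell-1},X_{j-1})\big)\\&+\sum_{\ell=1}^n\sum_{j=1}^\ell\varpi_{n,3}(\ell,j)P^2\bar G_{n,2}(X_{\ell-1},X_{j-1})+\epsilon_n,\end{aligned}$$ with $$\begin{aligned}\epsilon_n=&\sum_{\ell=1}^n\big(w_n(\ell,0)P\bar G_{n,2}(X_0,X_\ell)-w_n(\ell-1,0)P^2\bar G_{n,2}(X_0,X_{\ell-1})\big)\\&+\sum_{j=1}^nw_n(n,j)\big(P^2\bar G_{n,2}(X_n,X_j)-P\bar G_{n,2}(X_n,X_j)\big)\\&+\sum_{\ell=1}^n\big(w_n(\ell-1,\ell)P\bar G_{n,2}(X_{\ell-1},X_\ell)-w_n(\ell,\ell)P\bar G_{n,2}(X_\ell,X_\ell)\big).\end{aligned}$$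
   Context: $\{X_n,n\ge0\}$ is a (possibly nonstationary) Markov chain on a measurable space $(\mathcal X,\mathcal B)$ with countably generated sigma-algebra, with transition kernel $P$ and invariant probability distribution $\mu$. $P^0$ is the identity kernel and $P^n$ the $n$-th iterate. For $W:\mathbb T\to[1,\infty)$ and $f:\mathbb T\to\mathbb R$ measurable, $|f|_W:=\sup_{x}|f(x)|/W(x)$, and $\mathcal L_W$ is the set of measurable $f$ with $|f|_W<\infty$. For a finite signed measure $\nu$, $\|\nu\|_W:=\int W\,d|\nu|$. For a bivariate function $h$: $Ph(x,y):=\int P(x,dz)h(z,y)$ (first coordinate) and $P^2h(x_1,x_2):=\int P(x_1,dz_1)\int P(x_2,dz_2)h(z_1,z_2)$ (both coordinates). Condition $C(2,\bar V_2,\bar W_2)$: there is a finite constant $c$ such that $\sum_{\ell_1\ge0}\sum_{\ell_2\ge0}\|(P^{\ell_1}(x_1,\cdot)-\mu)\otimes(P^{\ell_2}(x_2,\cdot)-\mu)\|_{\bar V_2}\le c\,\bar W_2(x_1,x_2)$ for all $(x_1,x_2)\in\mathcal X^2$. Define $\bar R_2(x,y;(du,dv)):=\sum_{n_1\ge0}\sum_{n_2\ge0}(P^{n_1}(x,du)-\mu(du))\otimes(P^{n_2}(y,dv)-\mu(dv))$, $\theta_n:=\int\int h_n(x,y)\mu(dx)\mu(dy)$, $\bar h_{n,1}(x):=\int h_n(x,z)\mu(dz)-\theta_n$, $\bar h_{n,2}(x,y):=h_n(x,y)-\bar h_{n,1}(x)-\bar h_{n,1}(y)-\theta_n$, $\bar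 G_{n,2}(x,y):=\int\int\bar R_2(x,y;dz_1,dz_2)\bar h_{n,2}(z_1,z_2)$. For $1\le j\le\ell\le n$, $$Q_{n,\ell,j}:=\bar G_{n,2}(X_j,X_\ell)-P\bar G_{n,2}(X_{\ell-1},X_j)-P\bar G_{n,2}(X_{j-1},X_\ell)+P^2\bar G_{n,2}(X_{j-1},X_{\ell-1}).$$ Weights: $w_{n,1}(\ell):=\sum_{j=1}^\ell w_n(\ell,j)+\sum_{j=\ell}^nw_n(j,\ell)$; $\varpi_{n,1}(\ell,j):=w_n(\ell,j)-w_n(\ell-1,j)$; $\varpi_{n,2}(\ell,j):=w_n(\ell,j)-w_n(\ell,j-1)$; $\varpi_{n,3}(\ell,j):=w_n(\ell,j)+w_n(\ell-1,j-1)-w_n(\ell,j-1)-w_n(\ell-1,j)$. *)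

theory Defs
  imports "HOL-Probability.Probability"
begin

subsection \<open>Finite signed measures\<close>

text \<open>
  A finite signed measure on \<open>M\<close> is a real-valued, countably additive set function on
  \<open>sets M\<close>.  Values outside \<open>sets M\<close> are irrelevant.
\<close>

definition signed_measure :: "'a measure \<Rightarrow> ('a set \<Rightarrow> real) \<Rightarrow> bool" where
  "signed_measure M \<nu> \<longleftrightarrow>
     (\<forall>A :: nat \<Rightarrow> 'a set. range A \<subseteq> sets M \<longrightarrow> disjoint_family A \<longrightarrow>
        (\<lambda>i. \<nu> (A i)) sums \<nu> (\<Union>i. A i))"

text \<open>
  Jordan decomposition through the upper and lower variations.  As \<open>ennreal\<close> truncates negative
  numbers to 0 and \<open>{}\<close> competes in the supremum, the truncation does not change the supremum.
\<close>

definition upper_variation :: "'a measure \<Rightarrow> ('a set \<Rightarrow> real) \<Rightarrow> 'a measure" where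
  "upper_variation M \<nu> =
     measure_of (space M) (sets M) (\<lambda>A. SUP B\<in>{B \<in> sets M. B \<subseteq> A}. ennreal (\<nu> B))"

definition lower_variation :: "'a measure \<Rightarrow> ('a set \<Rightarrow> real) \<Rightarrow> 'a measure" where
  "lower_variation M \<nu> = upper_variation M (\<lambda>A. - \<nu> A)"

definition total_variation :: "'a measure \<Rightarrow> ('a set \<Rightarrow> real) \<Rightarrow> 'a measure" where
  "total_variation M \<nu> = measure_of (space M) (sets M)
     (\<lambda>A. emeasure (upper_variation M \<nu>) A + emeasure (lower_variation M \<nu>) A)"

definition signed_integral :: "'a measure \<Rightarrow> ('a set \<Rightarrow> real) \<Rightarrow> ('a \<Rightarrow> real) \<Rightarrow> real" where
  "signed_integral M \<nu> f =
     (\<integral>x. f x \<partial>upper_variation M \<nu>) - (\<integral>x. f x \<partial>lower_variation M \<nu>)"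

definition signed_prod :: "'a measure \<Rightarrow> ('a set \<Rightarrow> real) \<Rightarrow> ('b set \<Rightarrow> real) \<Rightarrow> ('a \<times> 'b) set \<Rightarrow> real" where
  "signed_prod M \<nu> \<kappa> A = signed_integral M \<nu> (\<lambda>x. \<kappa> (Pair x -` A))"

text \<open>
  \<open>measure_of\<close> silently yields the null measure when its argument is not countably additive; the
  following lemmas show that this does not happen for signed measures.
\<close>

lemma emeasure_upper_variation:
  assumes \<nu>: "signed_measure M \<nu>" and A: "A \<in> sets M"
  shows "emeasure (upper_variation M \<nu>) A = (SUP B\<in>{B \<in> sets M. B \<subseteq> A}. ennreal (\<nu> B))"
proof -
  define F where "F A = (SUP B\<in>{B \<in> sets M. B \<subseteq> A}. ennreal (\<nu> B))" for A
  have cadd: "(\<lambda>i. \<nu> (A i)) sums \<nu> (\<Union>i. A i)"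
    if "range A \<subseteq> sets M" "disjoint_family A" for A :: "nat \<Rightarrow> 'a set"
    using \<nu> that unfolding signed_measure_def by blast
  have "(\<lambda>_::nat. \<nu> {}) sums \<nu> (\<Union>_::nat. {})"
    by (rule cadd) (auto simp: disjoint_family_on_def)
  then have "summable (\<lambda>_::nat. \<nu> {})"
    by (rule sums_summable)
  then have empty: "\<nu> {} = 0"
    by (auto dest: summable_LIMSEQ_zero simp: LIMSEQ_const_iff)
  have add: "\<nu> (B \<union> C) = \<nu> B + \<nu> C" if "B \<in> sets M" "C \<in> sets M" "B \<inter> C = {}" for B C
  proof -
    let ?A = "\<lambda>i::nat. if i = 0 then B else if i = 1 then C else {}"
    have U: "(\<Union>i. ?A i) = B \<union> C"
      by (auto split: if_splits)
    have "(\<lambda>i. \<nu> (?A i)) sums \<nu> (\<Union>i. ?A i)"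
      using that by (intro cadd) (auto simp: disjoint_family_on_def)
    then have "(\<lambda>i. \<nu> (?A i)) sums \<nu> (B \<union> C)"
      by (simp only: U)
    moreover have "(\<lambda>i. \<nu> (?A i)) sums (\<Sum>i\<in>{0,1}. \<nu> (?A i))"
      by (rule sums_finite) (auto simp: empty)
    ultimately have "\<nu> (B \<union> C) = (\<Sum>i\<in>{0,1}. \<nu> (?A i))"
      by (rule sums_unique2)
    then show ?thesis
      by simp
  qed
  have upper: "ennreal (\<nu> B) \<le> F A" if "B \<in> sets M" "B \<subseteq> A" for A B
    unfolding F_def using that by (auto intro: SUP_upper)
  have mono: "F A \<le> F B" if "A \<subseteq> B" for A B
    unfolding F_def using that by (intro SUP_subset_mono) auto
  have super: "F A + F B \<le> F (A \<union> B)" if "A \<inter> B = {}" for A B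
  proof -
    have 1: "ennreal (\<nu> C) + ennreal (\<nu> D) \<le> F (A \<union> B)"
      if C: "C \<in> sets M" "C \<subseteq> A" and D: "D \<in> sets M" "D \<subseteq> B" for C D
    proof (cases "\<nu> C \<le> 0 \<or> \<nu> D \<le> 0")
      case True
      then show ?thesis
        using upper[OF C(1) le_supI1[OF C(2)]] upper[OF D(1) le_supI2[OF D(2)]]
        by (auto simp: ennreal_neg)
    next
      case False
      have "C \<inter> D = {}" using C D \<open>A \<inter> B = {}\<close> by blast
      then have "ennreal (\<nu> C) + ennreal (\<nu> D) = ennreal (\<nu> (C \<union> D))"
        using add[of C D] C D False by (simp add: ennreal_plus)
      also have "\<dots> \<le> F (A \<union> B)"
        using C D by (intro upper) auto
      finally show ?thesis .
    qed
    have ne: "{B \<in> sets M. B \<subseteq> X} \<noteq> {}" for X by auto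
    have "F A + F B = (SUP C\<in>{C \<in> sets M. C \<subseteq> A}. ennreal (\<nu> C) + F B)"
      unfolding F_def[of A] by (rule ennreal_SUP_add_left[symmetric, OF ne])
    also have "\<dots> \<le> F (A \<union> B)"
    proof (rule SUP_least)
      fix C assume C: "C \<in> {C \<in> sets M. C \<subseteq> A}"
      have "ennreal (\<nu> C) + F B = (SUP D\<in>{D \<in> sets M. D \<subseteq> B}. ennreal (\<nu> C) + ennreal (\<nu> D))"
        unfolding F_def by (rule ennreal_SUP_add_right[OF ne])
      also have "\<dots> \<le> F (A \<union> B)"
        using C by (intro SUP_least 1) auto
      finally show "ennreal (\<nu> C) + F B \<le> F (A \<union> B)" .
    qed
    finally show ?thesis .
  qed
  have F_empty: "F {} = 0"
    unfolding F_def by (simp add: empty cong: conj_cong)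
  have "countably_additive (sets M) F"
  proof (rule countably_additiveI)
    fix A :: "nat \<Rightarrow> 'a set" assume A: "range A \<subseteq> sets M" "disjoint_family A" "\<Union> (range A) \<in> sets M"
    show "(\<Sum>i. F (A i)) = F (\<Union> (range A))"
    proof (rule antisym)
      have "(\<Sum>i<n. F (A i)) \<le> F (\<Union>i<n. A i)" for n
      proof (induction n)
        case (Suc n)
        have "A i \<inter> A n = {}" if "i < n" for i
          using A(2) that unfolding disjoint_family_on_def by (metis UNIV_I less_irrefl)
        then have "(\<Union>i<n. A i) \<inter> A n = {}"
          by blast
        then have "F (\<Union>i<n. A i) + F (A n) \<le> F ((\<Union>i<n. A i) \<union> A n)"
          by (rule super)
        also have "(\<Union>i<n. A i) \<union> A n = (\<Union>i<Suc n. A i)"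
          by (simp add: lessThan_Suc Un_commute)
        finally have "F (\<Union>i<n. A i) + F (A n) \<le> F (\<Union>i<Suc n. A i)" .
        moreover have "(\<Sum>i<Suc n. F (A i)) \<le> F (\<Union>i<n. A i) + F (A n)"
          using Suc by (simp add: add_right_mono)
        ultimately show ?case
          by (rule order_trans[rotated])
      qed (simp add: F_empty)
      also have "F (\<Union>i<n. A i) \<le> F (\<Union> (range A))" for n
        by (rule mono) auto
      finally show "(\<Sum>i. F (A i)) \<le> F (\<Union> (range A))"
        by (intro suminf_le_const) auto
    next
      show "F (\<Union> (range A)) \<le> (\<Sum>i. F (A i))"
        unfolding F_def[of "\<Union> (range A)"]
      proof (rule SUP_least)
        fix B assume "B \<in> {B \<in> sets M. B \<subseteq> \<Union> (range A)}"
        then have B: "B \<in> sets M" "B = (\<Union>i. B \<inter> A i)" by auto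
        have "(\<lambda>i. \<nu> (B \<inter> A i)) sums \<nu> (\<Union>i. B \<inter> A i)"
        proof (rule cadd)
          show "range (\<lambda>i. B \<inter> A i) \<subseteq> sets M"
            using A(1) B(1) by auto
          show "disjoint_family (\<lambda>i. B \<inter> A i)"
            using A(2) unfolding disjoint_family_on_def by blast
        qed
        then have "(\<lambda>n. \<Sum>i<n. \<nu> (B \<inter> A i)) \<longlonglongrightarrow> \<nu> B"
          using B(2) by (simp add: sums_def)
        then have "(\<lambda>n. ennreal (\<Sum>i<n. \<nu> (B \<inter> A i))) \<longlonglongrightarrow> ennreal (\<nu> B)"
          by (rule tendsto_ennrealI)
        moreover have "ennreal (\<Sum>i<n. \<nu> (B \<inter> A i)) \<le> (\<Sum>i. F (A i))" for n
        proof -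
          have "ennreal (\<Sum>i<n. \<nu> (B \<inter> A i)) \<le> ennreal (\<Sum>i<n. max 0 (\<nu> (B \<inter> A i)))"
            by (intro ennreal_leI sum_mono) auto
          also have "\<dots> = (\<Sum>i<n. ennreal (max 0 (\<nu> (B \<inter> A i))))"
            by (rule sum_ennreal[symmetric]) simp
          also have "\<dots> \<le> (\<Sum>i<n. F (A i))"
            using A B(1) upper[of "B \<inter> A i" "A i" for i]
            by (intro sum_mono) (auto simp: max_def ennreal_neg)
          also have "\<dots> \<le> (\<Sum>i. F (A i))"
            by (rule sum_le_suminf) auto
          finally show ?thesis .
        qed
        ultimately show "ennreal (\<nu> B) \<le> (\<Sum>i. F (A i))"
          by (intro LIMSEQ_le_const2) auto
      qed
    qed
  qed
  then have "emeasure (measure_of (space M) (sets M) F) A = F A"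
    by (intro emeasure_measure_of_sigma sets.sigma_algebra_axioms A)
      (auto simp: positive_def F_empty)
  then show ?thesis
    unfolding upper_variation_def F_def .
qed

lemma signed_measure_uminus: "signed_measure M \<nu> \<Longrightarrow> signed_measure M (\<lambda>A. - \<nu> A)"
  unfolding signed_measure_def by (auto intro: sums_minus)

lemma emeasure_lower_variation:
  assumes "signed_measure M \<nu>" "A \<in> sets M"
  shows "emeasure (lower_variation M \<nu>) A = (SUP B\<in>{B \<in> sets M. B \<subseteq> A}. ennreal (- \<nu> B))"
  unfolding lower_variation_def
  using assms by (intro emeasure_upper_variation signed_measure_uminus)

lemma sets_upper_variation [simp]: "sets (upper_variation M \<nu>) = sets M"
  by (simp add: upper_variation_def)

lemma sets_lower_variation [simp]: "sets (lower_variation M \<nu>) = sets M"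
  by (simp add: lower_variation_def)

lemma emeasure_total_variation:
  assumes A: "A \<in> sets M"
  shows "emeasure (total_variation M \<nu>) A =
           emeasure (upper_variation M \<nu>) A + emeasure (lower_variation M \<nu>) A"
  unfolding total_variation_def
proof (rule emeasure_measure_of_sigma[OF sets.sigma_algebra_axioms _ _ A])
  show "countably_additive (sets M)
          (\<lambda>A. emeasure (upper_variation M \<nu>) A + emeasure (lower_variation M \<nu>) A)"
    by (auto intro!: countably_additiveI simp: suminf_add[symmetric] suminf_emeasure)
qed (auto simp: positive_def)

definition signed_norm :: "'a measure \<Rightarrow> ('a \<Rightarrow> real) \<Rightarrow> ('a set \<Rightarrow> real) \<Rightarrow> ennreal" where
  "signed_norm M W \<nu> = (\<integral>\<^sup>+x. ennreal (W x) \<partial>total_variation M \<nu>)"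

definition weighted_norm :: "'a measure \<Rightarrow> ('a \<Rightarrow> real) \<Rightarrow> ('a \<Rightarrow> real) \<Rightarrow> ennreal" where
  "weighted_norm T W f = (SUP x\<in>space T. ennreal (\<bar>f x\<bar> / W x))"

definition weighted_space :: "'a measure \<Rightarrow> ('a \<Rightarrow> real) \<Rightarrow> ('a \<Rightarrow> real) set" where
  "weighted_space T W = {f \<in> borel_measurable T. weighted_norm T W f < \<infinity>}"


subsection \<open>Kernels and Markov chains\<close>

definition countably_generated :: "'a measure \<Rightarrow> bool" where
  "countably_generated M \<longleftrightarrow>
     (\<exists>C. countable C \<and> C \<subseteq> Pow (space M) \<and> sets M = sigma_sets (space M) C)"

definition markov_kernel :: "'a measure \<Rightarrow> ('a \<Rightarrow> 'a measure) \<Rightarrow> bool" where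
  "markov_kernel M P \<longleftrightarrow> P \<in> M \<rightarrow>\<^sub>M prob_algebra M"

definition invariant_distribution :: "'a measure \<Rightarrow> ('a \<Rightarrow> 'a measure) \<Rightarrow> 'a measure \<Rightarrow> bool" where
  "invariant_distribution M P \<mu> \<longleftrightarrow> \<mu> \<in> space (prob_algebra M) \<and> \<mu> \<bind> P = \<mu>"

primrec kernel_power :: "'a measure \<Rightarrow> ('a \<Rightarrow> 'a measure) \<Rightarrow> nat \<Rightarrow> 'a \<Rightarrow> 'a measure" where
  "kernel_power M P 0 x = return M x"
| "kernel_power M P (Suc n) x = P x \<bind> kernel_power M P n"

text \<open>The sigma-algebra generated by \<open>X 0, \<dots>, X n\<close>.\<close>

definition past :: "'w measure \<Rightarrow> 'a measure \<Rightarrow> (nat \<Rightarrow> 'w \<Rightarrow> 'a) \<Rightarrow> nat \<Rightarrow> 'w measure" where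
  "past \<Omega> M X n = sigma (space \<Omega>) {X i -` A \<inter> space \<Omega> | i A. i \<le> n \<and> A \<in> sets M}"

text \<open>The initial distribution is arbitrary.\<close>

definition markov_chain ::
  "'w measure \<Rightarrow> 'a measure \<Rightarrow> ('a \<Rightarrow> 'a measure) \<Rightarrow> (nat \<Rightarrow> 'w \<Rightarrow> 'a) \<Rightarrow> bool" where
  "markov_chain \<Omega> M P X \<longleftrightarrow>
     prob_space \<Omega> \<and> (\<forall>n. X n \<in> \<Omega> \<rightarrow>\<^sub>M M) \<and>
     (\<forall>n. \<forall>A\<in>sets M. AE \<omega> in \<Omega>.
        real_cond_exp \<Omega> (past \<Omega> M X n) (indicat_real (X (Suc n) -` A \<inter> space \<Omega>)) \<omega>
          = measure (P (X n \<omega>)) A)"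

definition symmetric_on :: "'a set \<Rightarrow> ('a \<times> 'a \<Rightarrow> 'b) \<Rightarrow> bool" where
  "symmetric_on S f \<longleftrightarrow> (\<forall>x\<in>S. \<forall>y\<in>S. f (x, y) = f (y, x))"

definition centered_power ::
  "'a measure \<Rightarrow> ('a \<Rightarrow> 'a measure) \<Rightarrow> 'a measure \<Rightarrow> nat \<Rightarrow> 'a \<Rightarrow> 'a set \<Rightarrow> real" where
  "centered_power M P \<mu> n x A = measure (kernel_power M P n x) A - measure \<mu> A"

definition cond_C2 ::
  "'a measure \<Rightarrow> ('a \<Rightarrow> 'a measure) \<Rightarrow> 'a measure \<Rightarrow> ('a \<times> 'a \<Rightarrow> real) \<Rightarrow> ('a \<times> 'a \<Rightarrow> real) \<Rightarrow> bool" where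
  "cond_C2 M P \<mu> V W \<longleftrightarrow>
     (\<exists>c::real. \<forall>x\<^sub>1\<in>space M. \<forall>x\<^sub>2\<in>space M.
        (\<Sum>l\<^sub>1. \<Sum>l\<^sub>2. signed_norm (M \<Otimes>\<^sub>M M) V
           (signed_prod M (centered_power M P \<mu> l\<^sub>1 x\<^sub>1) (centered_power M P \<mu> l\<^sub>2 x\<^sub>2)))
        \<le> ennreal (c * W (x\<^sub>1, x\<^sub>2)))"

definition kernel_fst :: "('a \<Rightarrow> 'a measure) \<Rightarrow> ('a \<times> 'a \<Rightarrow> real) \<Rightarrow> 'a \<times> 'a \<Rightarrow> real" where
  "kernel_fst P f = (\<lambda>(x, y). \<integral>z. f (z, y) \<partial>P x)"

definition kernel_both :: "('a \<Rightarrow> 'a measure) \<Rightarrow> ('a \<times> 'a \<Rightarrow> real) \<Rightarrow> 'a \<times> 'a \<Rightarrow> real" where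
  "kernel_both P f = (\<lambda>(x\<^sub>1, x\<^sub>2). \<integral>z\<^sub>1. (\<integral>z\<^sub>2. f (z\<^sub>1, z\<^sub>2) \<partial>P x\<^sub>2) \<partial>P x\<^sub>1)"


subsection \<open>Projections of the U-statistic kernel and the potential kernel\<close>

definition theta :: "'a measure \<Rightarrow> ('a \<times> 'a \<Rightarrow> real) \<Rightarrow> real" where
  "theta \<mu> h = (\<integral>x. (\<integral>y. h (x, y) \<partial>\<mu>) \<partial>\<mu>)"

definition hbar1 :: "'a measure \<Rightarrow> ('a \<times> 'a \<Rightarrow> real) \<Rightarrow> 'a \<Rightarrow> real" where
  "hbar1 \<mu> h x = (\<integral>z. h (x, z) \<partial>\<mu>) - theta \<mu> h"

definition hbar2 :: "'a measure \<Rightarrow> ('a \<times> 'a \<Rightarrow> real) \<Rightarrow> 'a \<times> 'a \<Rightarrow> real" where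
  "hbar2 \<mu> h = (\<lambda>(x, y). h (x, y) - hbar1 \<mu> h x - hbar1 \<mu> h y - theta \<mu> h)"

definition Rbar2 ::
  "'a measure \<Rightarrow> ('a \<Rightarrow> 'a measure) \<Rightarrow> 'a measure \<Rightarrow> 'a \<Rightarrow> 'a \<Rightarrow> ('a \<times> 'a) set \<Rightarrow> real" where
  "Rbar2 M P \<mu> x y A =
     (\<Sum>n\<^sub>1. \<Sum>n\<^sub>2. signed_prod M (centered_power M P \<mu> n\<^sub>1 x) (centered_power M P \<mu> n\<^sub>2 y) A)"

definition Gbar2 ::
  "'a measure \<Rightarrow> ('a \<Rightarrow> 'a measure) \<Rightarrow> 'a measure \<Rightarrow> ('a \<times> 'a \<Rightarrow> real) \<Rightarrow> 'a \<times> 'a \<Rightarrow> real" where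
  "Gbar2 M P \<mu> h = (\<lambda>(x, y). signed_integral (M \<Otimes>\<^sub>M M) (Rbar2 M P \<mu> x y) (hbar2 \<mu> h))"


subsection \<open>Weights\<close>

text \<open>
  The increments below are only used for indices \<open>\<ge> 1\<close>, so the truncated subtraction on
  \<open>nat\<close> is the ordinary one.
\<close>

definition w1 :: "nat \<Rightarrow> (nat \<Rightarrow> nat \<Rightarrow> real) \<Rightarrow> nat \<Rightarrow> real" where
  "w1 n w l = (\<Sum>j=1..l. w l j) + (\<Sum>j=l..n. w j l)"

definition varpi1 :: "(nat \<Rightarrow> nat \<Rightarrow> real) \<Rightarrow> nat \<Rightarrow> nat \<Rightarrow> real" where
  "varpi1 w l j = w l j - w (l - 1) j"

definition varpi2 :: "(nat \<Rightarrow> nat \<Rightarrow> real) \<Rightarrow> nat \<Rightarrow> nat \<Rightarrow> real" where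
  "varpi2 w l j = w l j - w l (j - 1)"

definition varpi3 :: "(nat \<Rightarrow> nat \<Rightarrow> real) \<Rightarrow> nat \<Rightarrow> nat \<Rightarrow> real" where
  "varpi3 w l j = w l j + w (l - 1) (j - 1) - w l (j - 1) - w (l - 1) j"


subsection \<open>The terms of the decomposition\<close>

text \<open>
  These are functions of a trajectory \<open>x\<close> (later \<open>\<lambda>k. X k \<omega>\<close>).  In \<open>Qterm\<close>, \<open>zeta_term\<close> and
  \<open>eps_term\<close>, the argument \<open>G\<close> stands for \<open>Gbar2 M P \<mu> (h n)\<close>.
\<close>

definition U_stat :: "nat \<Rightarrow> (nat \<Rightarrow> nat \<Rightarrow> real) \<Rightarrow> ('a \<times> 'a \<Rightarrow> real) \<Rightarrow> (nat \<Rightarrow> 'a) \<Rightarrow> real" where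
  "U_stat n w h x = (\<Sum>l=1..n. \<Sum>j=1..l. w l j * h (x l, x j))"

definition U0 :: "'a measure \<Rightarrow> nat \<Rightarrow> (nat \<Rightarrow> nat \<Rightarrow> real) \<Rightarrow> ('a \<times> 'a \<Rightarrow> real) \<Rightarrow> real" where
  "U0 \<mu> n w h = theta \<mu> h * (\<Sum>l=1..n. \<Sum>j=1..l. w l j)"

definition Qterm ::
  "('a \<Rightarrow> 'a measure) \<Rightarrow> ('a \<times> 'a \<Rightarrow> real) \<Rightarrow> (nat \<Rightarrow> 'a) \<Rightarrow> nat \<Rightarrow> nat \<Rightarrow> real" where
  "Qterm P G x l j =
     G (x j, x l) - kernel_fst P G (x (l - 1), x j) - kernel_fst P G (x (j - 1), x l)
       + kernel_both P G (x (j - 1), x (l - 1))"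

definition eps_term ::
  "('a \<Rightarrow> 'a measure) \<Rightarrow> nat \<Rightarrow> (nat \<Rightarrow> nat \<Rightarrow> real) \<Rightarrow> ('a \<times> 'a \<Rightarrow> real) \<Rightarrow> (nat \<Rightarrow> 'a) \<Rightarrow> real" where
  "eps_term P n w G x =
     (\<Sum>l=1..n. w l 0 * kernel_fst P G (x 0, x l)
                 - w (l - 1) 0 * kernel_both P G (x 0, x (l - 1)))
   + (\<Sum>j=1..n. w n j * (kernel_both P G (x n, x j) - kernel_fst P G (x n, x j)))
   + (\<Sum>l=1..n. w (l - 1) l * kernel_fst P G (x (l - 1), x l)
                 - w l l * kernel_fst P G (x l, x l))"

definition zeta_term ::
  "('a \<Rightarrow> 'a measure) \<Rightarrow> nat \<Rightarrow> (nat \<Rightarrow> nat \<Rightarrow> real) \<Rightarrow> ('a \<times> 'a \<Rightarrow> real) \<Rightarrow> (nat \<Rightarrow> 'a) \<Rightarrow> real" where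
  "zeta_term P n w G x =
     (\<Sum>l=1..n. \<Sum>j=1..l. varpi1 w l j *
        (kernel_fst P G (x (l - 1), x j) - kernel_both P G (x (l - 1), x (j - 1))))
   + (\<Sum>l=1..n. \<Sum>j=1..l. varpi2 w l j *
        (kernel_fst P G (x (j - 1), x l) - kernel_both P G (x (l - 1), x (j - 1))))
   + (\<Sum>l=1..n. \<Sum>j=1..l. varpi3 w l j * kernel_both P G (x (l - 1), x (j - 1)))
   + eps_term P n w G x"

end

theory Submission
  imports Defs
begin

text \<open>
  Write \<open>\<nu>\<^sub>n\<^sub>m = (P\<^sup>n(x, \<cdot>) - \<mu>) \<otimes> (P\<^sup>m(y, \<cdot>) - \<mu>)\<close>. As \<open>hbar2\<close> integrates to \<open>0\<close> against \<open>\<mu>\<close> in each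
  coordinate, its integral against \<open>\<nu>\<^sub>n\<^sub>m\<close> is \<open>T\<^sub>n\<^sub>m(x, y) = \<integral>\<integral> hbar2 dP\<^sup>n(x, \<cdot>) dP\<^sup>m(y, \<cdot>)\<close>, and the potential \<open>G\<close>
  is the sum of all \<open>T\<^sub>n\<^sub>m\<close>. Applying \<open>P\<close> to one coordinate shifts the corresponding index by one,
  so inclusion-exclusion over the double series leaves only \<open>T\<^sub>0\<^sub>0\<close>, which gives the Poisson equation
  \<open>hbar2 (x, y) = G (x, y) - PG (x, y) - PG (y, x) + P\<^sup>2G (x, y)\<close> at every pair of points.
  Inserting it in the statistic and summing by parts, row by row, yields the decomposition, so that
  it holds along every trajectory.
\<close>

section \<open>Sums of measures\<close>

text \<open>\<open>signed_integral\<close> is defined through the upper and lower variations, while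
  the centred products and \<open>Rbar2\<close> are known only by their values on sets. So it must
  be shown that the integral does not depend on the pair of finite measures whose difference
  represents the set function. For \<open>Rbar2\<close> such a pair arises by summing the upper and
  the lower variations of all centred products separately; both sums are finite by C2, since
  \<open>V\<close> is at least 1. Two obstacles shape the rest. C2 bounds signed products only, but
  splitting an integral of \<open>hbar2\<close> into its four unsigned parts requires
  \<open>V\<close> to be integrable against each part. And the Poisson equation is needed at every
  pair of points, because the law of the chain may be singular to \<mu>; the almost-everywhere
  statements of Fubini do not suffice. Here the absolute double series is bounded pointwise by a
  multiple of \<open>W\<close>, and the finiteness of the one-step averages of \<open>W\<close> at
  each pair then justifies every interchange at that very pair.\<close>

definition sum_measure :: "'a measure \<Rightarrow> ('i \<Rightarrow> 'a measure) \<Rightarrow> 'a measure" where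
  "sum_measure M \<kappa> = measure_of (space M) (sets M) (\<lambda>A. \<integral>\<^sup>+i. emeasure (\<kappa> i) A \<partial>count_space UNIV)"

lemma sets_sum_measure [simp, measurable_cong]: "sets (sum_measure M \<kappa>) = sets M"
  by (simp add: sum_measure_def)

lemma space_sum_measure [simp]: "space (sum_measure M \<kappa>) = space M"
  by (simp add: sum_measure_def)

lemma emeasure_sum_measure:
  assumes "\<And>i. sets (\<kappa> i) = sets M" and A: "A \<in> sets M"
  shows "emeasure (sum_measure M \<kappa>) A = (\<integral>\<^sup>+i. emeasure (\<kappa> i) A \<partial>count_space UNIV)"
  unfolding sum_measure_def
proof (rule emeasure_measure_of_sigma[OF sets.sigma_algebra_axioms _ _ A])
  show "countably_additive (sets M) (\<lambda>A. \<integral>\<^sup>+i. emeasure (\<kappa> i) A \<partial>count_space UNIV)"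
  proof (rule countably_additiveI)
    fix A :: "nat \<Rightarrow> _ set"
    assume "range A \<subseteq> sets M" "disjoint_family A"
    then have "(\<Sum>n. emeasure (\<kappa> i) (A n)) = emeasure (\<kappa> i) (\<Union> (range A))" for i
      using assms(1) by (intro suminf_emeasure) auto
    then show "(\<Sum>n. \<integral>\<^sup>+i. emeasure (\<kappa> i) (A n) \<partial>count_space UNIV) =
        (\<integral>\<^sup>+i. emeasure (\<kappa> i) (\<Union> (range A)) \<partial>count_space UNIV)"
      by (subst nn_integral_suminf[symmetric]) auto
  qed
qed (auto simp: positive_def)

text \<open>Summing by an integral over counting measure leaves the index type free:
  \<open>bool\<close> for two measures, finite types for domination, pairs of naturals for the
  double series. Monotone convergence over the index settles the limit step.\<close>

lemma nn_integral_sum_measure: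
  assumes \<kappa>: "\<And>i. sets (\<kappa> i) = sets M" and f: "f \<in> borel_measurable M"
  shows "(\<integral>\<^sup>+x. f x \<partial>sum_measure M \<kappa>) = (\<integral>\<^sup>+i. (\<integral>\<^sup>+x. f x \<partial>\<kappa> i) \<partial>count_space UNIV)"
  using f
proof (induction rule: borel_measurable_induct)
  case (cong f g)
  have "space (\<kappa> i) = space M" for i
    using \<kappa> by (rule sets_eq_imp_space_eq)
  then have "(\<integral>\<^sup>+x. f x \<partial>\<kappa> i) = (\<integral>\<^sup>+x. g x \<partial>\<kappa> i)" for i
    using cong by (intro nn_integral_cong) auto
  moreover have "(\<integral>\<^sup>+x. f x \<partial>sum_measure M \<kappa>) = (\<integral>\<^sup>+x. g x \<partial>sum_measure M \<kappa>)"
    using cong by (intro nn_integral_cong) auto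
  ultimately show ?case
    using cong by simp
next
  case (set A)
  then show ?case
    using \<kappa> by (simp add: emeasure_sum_measure)
next
  case (mult u c)
  then have "u \<in> borel_measurable (\<kappa> i)" for i
    by (simp add: measurable_cong_sets[OF \<kappa> refl])
  with mult show ?case
    by (simp add: nn_integral_cmult)
next
  case (add u v)
  then have "u \<in> borel_measurable (\<kappa> i)" "v \<in> borel_measurable (\<kappa> i)" for i
    by (simp_all add: measurable_cong_sets[OF \<kappa> refl])
  with add show ?case
    by (simp add: nn_integral_add)
next
  case (seq U)
  then have [measurable]: "U n \<in> borel_measurable (\<kappa> i)" for n i
    by (simp add: measurable_cong_sets[OF \<kappa> refl])
  have *: "(\<integral>\<^sup>+x. (SUP n. U n x) \<partial>\<kappa> i) = (SUP n. \<integral>\<^sup>+x. U n x \<partial>\<kappa> i)" for i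
    by (rule nn_integral_monotone_convergence_SUP[OF seq(3)]) measurable
  have "(\<integral>\<^sup>+x. (SUP n. U n x) \<partial>sum_measure M \<kappa>) = (SUP n. \<integral>\<^sup>+x. U n x \<partial>sum_measure M \<kappa>)"
    using seq by (intro nn_integral_monotone_convergence_SUP) auto
  also have "\<dots> = (SUP n. \<integral>\<^sup>+i. (\<integral>\<^sup>+x. U n x \<partial>\<kappa> i) \<partial>count_space UNIV)"
    using seq by simp
  also have "\<dots> = (\<integral>\<^sup>+i. (SUP n. \<integral>\<^sup>+x. U n x \<partial>\<kappa> i) \<partial>count_space UNIV)"
    using seq(3)
    by (intro nn_integral_monotone_convergence_SUP[symmetric])
      (auto simp: incseq_def le_fun_def intro!: nn_integral_mono)
  finally show ?case
    by (simp add: * SUP_apply[abs_def])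
qed

text \<open>Both measures have the same simple functions, and simple integrals are monotone in the
  measure.\<close>

lemma nn_integral_mono_emeasure:
  assumes "sets N = sets M" and le: "\<And>A. A \<in> sets M \<Longrightarrow> emeasure M A \<le> emeasure N A"
  shows "(\<integral>\<^sup>+x. f x \<partial>M) \<le> (\<integral>\<^sup>+x. f x \<partial>N)"
proof -
  note [simp] = sets_eq_imp_space_eq[OF assms(1)]
  have sf: "simple_function M g \<longleftrightarrow> simple_function N g" for g :: "'a \<Rightarrow> ennreal"
    using assms(1) by (simp add: simple_function_def)
  have "integral\<^sup>S M g \<le> integral\<^sup>S N g" if "simple_function M g" for g
    using that le
    by (auto simp: simple_integral_def simple_function_def intro!: sum_mono mult_left_mono)
  then show ?thesis
    unfolding nn_integral_def by (auto simp: sf intro!: SUP_mono)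
qed

text \<open>Transfers integrability of \<open>V\<close> to an unsigned product once that product is
  dominated, set by set, by finitely many measures that integrate \<open>V\<close>.\<close>

lemma nn_integral_dominated_finite:
  fixes \<kappa> :: "'i::finite \<Rightarrow> 'a measure"
  assumes "sets N = sets M" "\<And>i. sets (\<kappa> i) = sets M" "f \<in> borel_measurable M"
    and "\<And>A. A \<in> sets M \<Longrightarrow> emeasure N A \<le> (\<Sum>i\<in>UNIV. emeasure (\<kappa> i) A)"
    and "\<And>i. (\<integral>\<^sup>+x. f x \<partial>\<kappa> i) < \<infinity>"
  shows "(\<integral>\<^sup>+x. f x \<partial>N) < \<infinity>"
proof -
  have "(\<integral>\<^sup>+x. f x \<partial>N) \<le> (\<integral>\<^sup>+x. f x \<partial>sum_measure M \<kappa>)"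
    using assms
    by (intro nn_integral_mono_emeasure) (auto simp: emeasure_sum_measure nn_integral_count_space_finite)
  also have "\<dots> = (\<Sum>i\<in>UNIV. \<integral>\<^sup>+x. f x \<partial>\<kappa> i)"
    using assms by (simp add: nn_integral_sum_measure nn_integral_count_space_finite)
  also have "\<dots> < \<infinity>"
    using assms(5) by (simp add: less_top[symmetric])
  finally show ?thesis .
qed

text \<open>The measure \<open>B\<close> is the mixture of the \<kappa> i under \<open>N\<close>.
  With counting measure this integrates against a sum of measures; with \<open>P x\<close> it is the
  Chapman-Kolmogorov step. Only the mixture integral is assumed finite, so single \<kappa> i may
  fail to integrate \<open>f\<close>.\<close>

lemma integral_mixture:
  fixes f :: "'a \<Rightarrow> real"
  assumes f: "integrable B f"
    and sets: "\<And>i. i \<in> space N \<Longrightarrow> sets (\<kappa> i) = sets B"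
    and meas: "\<And>g :: 'a \<Rightarrow> ennreal. g \<in> borel_measurable B \<Longrightarrow> (\<lambda>i. \<integral>\<^sup>+x. g x \<partial>\<kappa> i) \<in> borel_measurable N"
    and mix: "\<And>g :: 'a \<Rightarrow> ennreal. g \<in> borel_measurable B \<Longrightarrow>
      (\<integral>\<^sup>+x. g x \<partial>B) = (\<integral>\<^sup>+i. (\<integral>\<^sup>+x. g x \<partial>\<kappa> i) \<partial>N)"
  shows "integrable N (\<lambda>i. \<integral>x. f x \<partial>\<kappa> i)"
    and "(\<integral>x. f x \<partial>B) = (\<integral>i. (\<integral>x. f x \<partial>\<kappa> i) \<partial>N)"
proof -
  have fm [measurable]: "f \<in> borel_measurable B"
    using f by auto
  \<comment> \<open>\<open>enn2real\<close> sends \<infinity> to 0, which alters the two part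
    integrals only on the null sets of \<open>ae_pos\<close> and \<open>ae_neg\<close>.\<close>
  define F where "F i = enn2real (\<integral>\<^sup>+x. f x \<partial>\<kappa> i)" for i
  define F' where "F' i = enn2real (\<integral>\<^sup>+x. ennreal (- f x) \<partial>\<kappa> i)" for i
  have [measurable]: "F \<in> borel_measurable N" "F' \<in> borel_measurable N"
    unfolding F_def F'_def using meas by (auto intro!: measurable_compose[OF meas])
  have m: "(\<lambda>i. \<integral>\<^sup>+x. ennreal \<bar>f x\<bar> \<partial>\<kappa> i) \<in> borel_measurable N"
    by (rule meas) auto
  have fin: "(\<integral>\<^sup>+x. ennreal \<bar>f x\<bar> \<partial>B) < \<infinity>" "(\<integral>\<^sup>+x. f x \<partial>B) < \<infinity>" "(\<integral>\<^sup>+x. ennreal (- f x) \<partial>B) < \<infinity>"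
    using f unfolding real_integrable_def by (auto simp: less_top integrable_iff_bounded)
       (use f in \<open>auto simp: integrable_iff_bounded less_top\<close>)
  have fk: "f \<in> borel_measurable (\<kappa> i)" if "i \<in> space N" for i
    using fm by (simp add: measurable_cong_sets[OF sets[OF that] refl])
  \<comment> \<open>Where \<open>f\<close> is not integrable, the Bochner integral is 0 by default.
    Making this case explicit gives a formula valid at every index, hence measurability in
    \<open>i\<close>.\<close>
  have int_eq: "(\<integral>x. f x \<partial>\<kappa> i) = (if (\<integral>\<^sup>+x. ennreal \<bar>f x\<bar> \<partial>\<kappa> i) < \<infinity> then F i - F' i else 0)"
    if "i \<in> space N" for i
  proof (cases "integrable (\<kappa> i) f")
    case True
    then show ?thesis
      using real_lebesgue_integral_def[OF True] by (simp add: F_def F'_def integrable_iff_bounded)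
  next
    case False
    then show ?thesis
      using fk[OF that] by (simp add: not_integrable_integral_eq integrable_iff_bounded)
  qed
  have meas_int: "(\<lambda>i. \<integral>x. f x \<partial>\<kappa> i) \<in> borel_measurable N"
    using m by (subst measurable_cong[OF int_eq]) auto
  have ae: "AE i in N. (\<integral>\<^sup>+x. ennreal \<bar>f x\<bar> \<partial>\<kappa> i) \<noteq> \<infinity>"
    using fin(1) m by (intro nn_integral_PInf_AE) (auto simp: mix[symmetric])
  have ae_pos: "AE i in N. (\<integral>\<^sup>+x. f x \<partial>\<kappa> i) \<noteq> \<infinity>"
    using fin(2) by (intro nn_integral_PInf_AE meas) (auto simp: mix[symmetric])
  have ae_neg: "AE i in N. (\<integral>\<^sup>+x. ennreal (- f x) \<partial>\<kappa> i) \<noteq> \<infinity>"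
    using fin(3) by (intro nn_integral_PInf_AE meas) (auto simp: mix[symmetric])
  have F: "(\<integral>\<^sup>+i. F i \<partial>N) = (\<integral>\<^sup>+x. f x \<partial>B)"
    by (subst mix, simp, rule nn_integral_cong_AE)
      (use ae_pos in \<open>auto elim!: eventually_mono simp: F_def less_top\<close>)
  have F': "(\<integral>\<^sup>+i. F' i \<partial>N) = (\<integral>\<^sup>+x. ennreal (- f x) \<partial>B)"
    by (subst mix, simp, rule nn_integral_cong_AE)
      (use ae_neg in \<open>auto elim!: eventually_mono simp: F'_def less_top\<close>)
  have nn: "F i \<ge> 0" "F' i \<ge> 0" for i
    by (auto simp: F_def F'_def)
  have intF: "integrable N F" "integrable N F'"
    using fin F F' nn by (auto simp: integrable_iff_bounded)
  have eq: "AE i in N. (\<integral>x. f x \<partial>\<kappa> i) = F i - F' i"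
    using ae AE_space by eventually_elim (simp add: int_eq less_top)
  show "integrable N (\<lambda>i. \<integral>x. f x \<partial>\<kappa> i)"
    using eq meas_int intF by (subst integrable_cong_AE[OF _ _ eq]) auto
  have "(\<integral>i. (\<integral>x. f x \<partial>\<kappa> i) \<partial>N) = (\<integral>i. F i - F' i \<partial>N)"
    using eq meas_int by (intro integral_cong_AE) auto
  also have "\<dots> = enn2real (\<integral>\<^sup>+i. F i \<partial>N) - enn2real (\<integral>\<^sup>+i. F' i \<partial>N)"
    using intF nn by (simp add: integral_eq_nn_integral)
  also have "\<dots> = (\<integral>x. f x \<partial>B)"
    by (simp add: F F' real_lebesgue_integral_def[OF f])
  finally show "(\<integral>x. f x \<partial>B) = (\<integral>i. (\<integral>x. f x \<partial>\<kappa> i) \<partial>N)" ..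
qed

section \<open>Signed measures as differences of finite measures\<close>

lemma signed_measure_diff:
  assumes "finite_measure a" "finite_measure b" "sets a = sets M" "sets b = sets M"
    and \<nu>: "\<And>A. A \<in> sets M \<Longrightarrow> \<nu> A = measure a A - measure b A"
  shows "signed_measure M \<nu>"
  unfolding signed_measure_def
proof (intro allI impI)
  fix A :: "nat \<Rightarrow> 'a set" assume A: "range A \<subseteq> sets M" "disjoint_family A"
  have "(\<lambda>i. measure a (A i) - measure b (A i)) sums (measure a (\<Union>i. A i) - measure b (\<Union>i. A i))"
    using A assms by (intro sums_diff finite_measure.finite_measure_UNION) auto
  moreover have "(\<Union>i. A i) \<in> sets M" "A i \<in> sets M" for i
    using A by auto
  ultimately show "(\<lambda>i. \<nu> (A i)) sums \<nu> (\<Union>i. A i)"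
    by (simp add: \<nu>)
qed

lemma sets_total_variation [simp, measurable_cong]: "sets (total_variation M \<nu>) = sets M"
  by (simp add: total_variation_def)

lemma nn_integral_total_variation:
  assumes "f \<in> borel_measurable M"
  shows "(\<integral>\<^sup>+x. f x \<partial>total_variation M \<nu>) =
    (\<integral>\<^sup>+x. f x \<partial>upper_variation M \<nu>) + (\<integral>\<^sup>+x. f x \<partial>lower_variation M \<nu>)"
proof -
  define \<kappa> where "\<kappa> b = (if b then upper_variation M \<nu> else lower_variation M \<nu>)" for b
  have \<kappa>: "sets (\<kappa> b) = sets M" for b
    by (simp add: \<kappa>_def)
  have "total_variation M \<nu> = sum_measure M \<kappa>"
    by (rule measure_eqI)
      (simp_all add: emeasure_total_variation emeasure_sum_measure[OF \<kappa>] nn_integral_count_space_finite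
        UNIV_bool \<kappa>_def)
  then show ?thesis
    using assms by (simp add: nn_integral_sum_measure[OF \<kappa>] nn_integral_count_space_finite UNIV_bool \<kappa>_def)
qed

text \<open>This is how a finite \<open>signed_norm\<close> gives control over the values on
  individual sets.\<close>

lemma abs_le_total_variation:
  assumes "signed_measure M \<nu>" "A \<in> sets M"
  shows "ennreal \<bar>\<nu> A\<bar> \<le> emeasure (total_variation M \<nu>) A"
proof -
  have "ennreal (\<nu> A) \<le> emeasure (upper_variation M \<nu>) A"
    using assms by (auto simp: emeasure_upper_variation intro!: SUP_upper)
  moreover have "ennreal (- \<nu> A) \<le> emeasure (lower_variation M \<nu>) A"
    using assms by (auto simp: emeasure_lower_variation intro!: SUP_upper)
  moreover have "ennreal \<bar>\<nu> A\<bar> \<le> ennreal (\<nu> A) + ennreal (- \<nu> A)"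
    by (cases "\<nu> A \<ge> 0") (auto simp: ennreal_neg)
  ultimately show ?thesis
    using assms by (simp add: emeasure_total_variation) (meson add_mono order_trans)
qed

text \<open>Minimality of the Jordan decomposition: for \<open>B\<close> inside \<open>A\<close>,
  the value at \<open>B\<close> is at most the \<open>a\<close>-mass of \<open>B\<close>, hence of
  \<open>A\<close>. Finiteness of the variation, and integrability under it, follow from
  \<open>a\<close>.\<close>

lemma upper_variation_le:
  assumes "finite_measure a" "finite_measure b" "sets a = sets M" "sets b = sets M"
    and \<nu>: "\<And>A. A \<in> sets M \<Longrightarrow> \<nu> A = measure a A - measure b A" and A: "A \<in> sets M"
  shows "emeasure (upper_variation M \<nu>) A \<le> emeasure a A"
proof -
  interpret a: finite_measure a by fact
  have "ennreal (\<nu> B) \<le> emeasure a A" if "B \<in> sets M" "B \<subseteq> A" for B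
  proof -
    have "\<nu> B \<le> measure a B" using that \<nu> by simp
    also have "\<dots> \<le> measure a A" using that A assms by (intro a.finite_measure_mono) auto
    finally show ?thesis by (simp add: a.emeasure_eq_measure ennreal_leI)
  qed
  then show ?thesis
    using signed_measure_diff[OF assms(1-5)] A by (auto simp: emeasure_upper_variation intro!: SUP_least)
qed

lemma lower_variation_le:
  assumes "finite_measure a" "finite_measure b" "sets a = sets M" "sets b = sets M"
    and \<nu>: "\<And>A. A \<in> sets M \<Longrightarrow> \<nu> A = measure a A - measure b A" and A: "A \<in> sets M"
  shows "emeasure (lower_variation M \<nu>) A \<le> emeasure b A"
  unfolding lower_variation_def using assms by (intro upper_variation_le[of b a]) auto

lemma finite_measure_dominated:
  assumes "finite_measure a" "sets b = sets a" "\<And>A. A \<in> sets a \<Longrightarrow> emeasure b A \<le> emeasure a A"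
  shows "finite_measure b"
proof
  interpret finite_measure a by fact
  have "emeasure b (space b) \<le> emeasure a (space a)"
    using assms(3)[of "space a"] sets_eq_imp_space_eq[OF assms(2)] by simp
  then show "emeasure b (space b) \<noteq> \<infinity>"
    using emeasure_finite[of "space a"] by (auto simp: top_unique)
qed

text \<open>The Jordan decomposition without a Hahn set. For \<open>B\<close> inside
  \<open>A\<close>, the value at \<open>B\<close> equals the value at \<open>A\<close> minus the
  value at \<open>A - B\<close>; taking suprema over \<open>B\<close> in both directions compares
  the two variations.\<close>

lemma upper_minus_lower_variation:
  assumes "finite_measure a" "finite_measure b" "sets a = sets M" "sets b = sets M"
    and \<nu>: "\<And>A. A \<in> sets M \<Longrightarrow> \<nu> A = measure a A - measure b A" and A: "A \<in> sets M"
  shows "measure (upper_variation M \<nu>) A - measure (lower_variation M \<nu>) A = \<nu> A"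
proof -
  interpret a: finite_measure a by fact
  interpret b: finite_measure b by fact
  have sm: "signed_measure M \<nu>"
    using assms by (intro signed_measure_diff[of a b]) auto
  let ?U = "upper_variation M \<nu>" and ?L = "lower_variation M \<nu>"
  interpret U: finite_measure ?U
    using assms upper_variation_le[OF assms(1-5)] by (intro finite_measure_dominated[OF assms(1)]) auto
  interpret L: finite_measure ?L
    using assms lower_variation_le[OF assms(1-5)] by (intro finite_measure_dominated[OF assms(2)]) auto
  have split: "\<nu> A = \<nu> B + \<nu> (A - B)" if "B \<in> sets M" "B \<subseteq> A" for B
    using that A assms \<nu> by (simp add: a.finite_measure_Diff b.finite_measure_Diff)
  have Uge: "\<nu> B \<le> measure ?U A" and Lge: "- \<nu> B \<le> measure ?L A" if "B \<in> sets M" "B \<subseteq> A" for B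
  proof -
    have "ennreal (\<nu> B) \<le> emeasure ?U A"
      using that A sm by (auto simp: emeasure_upper_variation intro!: SUP_upper)
    then show "\<nu> B \<le> measure ?U A"
      by (cases "\<nu> B \<ge> 0") (auto simp: U.emeasure_eq_measure intro: order_trans[OF _ measure_nonneg])
    have "ennreal (- \<nu> B) \<le> emeasure ?L A"
      using that A sm by (auto simp: emeasure_lower_variation intro!: SUP_upper)
    then show "- \<nu> B \<le> measure ?L A"
      by (cases "- \<nu> B \<ge> 0") (auto simp: L.emeasure_eq_measure intro: order_trans[OF _ measure_nonneg])
  qed
  have "emeasure ?U A \<le> ennreal (\<nu> A + measure ?L A)"
  proof (subst emeasure_upper_variation[OF sm A], intro SUP_least ennreal_leI)
    fix B assume "B \<in> {B \<in> sets M. B \<subseteq> A}"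
    then show "\<nu> B \<le> \<nu> A + measure ?L A"
      using split[of B] Lge[of "A - B"] A by auto
  qed
  \<comment> \<open>Since \<open>ennreal\<close> truncates negative numbers, the bound can be read
    back in the reals only once its right side is known to be nonnegative.\<close>
  moreover have "\<nu> A + measure ?L A \<ge> 0"
    using Lge[of A] A by auto
  ultimately have 1: "measure ?U A \<le> \<nu> A + measure ?L A"
    by (simp add: U.emeasure_eq_measure)
  have "emeasure ?L A \<le> ennreal (measure ?U A - \<nu> A)"
  proof (subst emeasure_lower_variation[OF sm A], intro SUP_least ennreal_leI)
    fix B assume "B \<in> {B \<in> sets M. B \<subseteq> A}"
    then show "- \<nu> B \<le> measure ?U A - \<nu> A"
      using split[of B] Uge[of "A - B"] A by auto
  qed
  moreover have "measure ?U A - \<nu> A \<ge> 0"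
    using Uge[of A] A by auto
  ultimately have "measure ?L A \<le> measure ?U A - \<nu> A"
    by (simp add: L.emeasure_eq_measure)
  with 1 show ?thesis by simp
qed

text \<open>An equality of differences in additive form, as measures cannot be subtracted: both
  sides are the integral against one and the same sum of measures.\<close>

lemma integral_eq_if_measure_add_eq:
  fixes f :: "'a \<Rightarrow> real"
  assumes sets: "sets a = sets M" "sets b = sets M" "sets c = sets M" "sets d = sets M"
    and int: "integrable a f" "integrable b f" "integrable c f" "integrable d f"
    and eq: "\<And>A. A \<in> sets M \<Longrightarrow> emeasure a A + emeasure b A = emeasure c A + emeasure d A"
  shows "(\<integral>x. f x \<partial>a) + (\<integral>x. f x \<partial>b) = (\<integral>x. f x \<partial>c) + (\<integral>x. f x \<partial>d)"
proof -
  define \<kappa> where "\<kappa> i = (if i then a else b)" for i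
  define \<eta> where "\<eta> i = (if i then c else d)" for i
  have \<kappa>: "sets (\<kappa> i) = sets M" and \<eta>: "sets (\<eta> i) = sets M" for i
    using sets by (auto simp: \<kappa>_def \<eta>_def)
  have [measurable]: "f \<in> borel_measurable M"
    using borel_measurable_integrable[OF int(1)] by (simp add: measurable_cong_sets[OF sets(1) refl])
  have same: "sum_measure M \<kappa> = sum_measure M \<eta>"
    using eq by (intro measure_eqI)
      (auto simp: emeasure_sum_measure[OF \<kappa>] emeasure_sum_measure[OF \<eta>] nn_integral_count_space_finite UNIV_bool \<kappa>_def \<eta>_def add.commute)
  have fin: "integrable (sum_measure M \<kappa>) f"
    unfolding integrable_iff_bounded using int
    by (auto simp: nn_integral_sum_measure[OF \<kappa>] nn_integral_count_space_finite UNIV_bool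
        \<kappa>_def integrable_iff_bounded)
  have "(\<integral>x. f x \<partial>a) + (\<integral>x. f x \<partial>b) = (\<integral>x. f x \<partial>sum_measure M \<kappa>)"
    by (subst integral_mixture(2)[OF fin, where \<kappa> = \<kappa> and N = "count_space UNIV"])
      (auto simp: \<kappa> nn_integral_sum_measure measurable_cong_sets[OF sets_sum_measure refl]
        lebesgue_integral_count_space_finite UNIV_bool, simp add: \<kappa>_def)
  also have "\<dots> = (\<integral>x. f x \<partial>c) + (\<integral>x. f x \<partial>d)"
    by (subst integral_mixture(2)[OF fin, where \<kappa> = \<eta> and N = "count_space UNIV"])
      (auto simp: same \<eta> nn_integral_sum_measure measurable_cong_sets[OF sets_sum_measure refl]
        lebesgue_integral_count_space_finite UNIV_bool, simp add: \<eta>_def)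
  finally show ?thesis .
qed

lemma integrable_dominated_measure:
  fixes f :: "'a \<Rightarrow> real"
  assumes "integrable a f" "sets b = sets a" "\<And>A. A \<in> sets a \<Longrightarrow> emeasure b A \<le> emeasure a A"
  shows "integrable b f"
proof -
  have "f \<in> borel_measurable b"
    using borel_measurable_integrable[OF assms(1)] by (simp add: measurable_cong_sets[OF assms(2) refl])
  moreover have "(\<integral>\<^sup>+x. ennreal \<bar>f x\<bar> \<partial>b) \<le> (\<integral>\<^sup>+x. ennreal \<bar>f x\<bar> \<partial>a)"
    using assms by (intro nn_integral_mono_emeasure) auto
  ultimately show ?thesis
    using assms(1) by (auto simp: integrable_iff_bounded intro: le_less_trans)
qed

text \<open>Independence of the representing pair. The difference of the variations equals that of
  \<open>a\<close> and \<open>b\<close>; moving terms across gives an equality of sums of finite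
  measures, to which the additive comparison applies.\<close>

lemma signed_integral_diff:
  fixes f :: "'a \<Rightarrow> real"
  assumes fin: "finite_measure a" "finite_measure b" and sets: "sets a = sets M" "sets b = sets M"
    and \<nu>: "\<And>A. A \<in> sets M \<Longrightarrow> \<nu> A = measure a A - measure b A"
    and int: "integrable a f" "integrable b f"
  shows "signed_integral M \<nu> f = (\<integral>x. f x \<partial>a) - (\<integral>x. f x \<partial>b)"
proof -
  interpret a: finite_measure a by fact
  interpret b: finite_measure b by fact
  let ?U = "upper_variation M \<nu>" and ?L = "lower_variation M \<nu>"
  note le = upper_variation_le[OF fin sets \<nu>] lower_variation_le[OF fin sets \<nu>]
  interpret U: finite_measure ?U
    using sets le by (intro finite_measure_dominated[OF fin(1)]) auto
  interpret L: finite_measure ?L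
    using sets le by (intro finite_measure_dominated[OF fin(2)]) auto
  have "(\<integral>x. f x \<partial>?U) + (\<integral>x. f x \<partial>b) = (\<integral>x. f x \<partial>?L) + (\<integral>x. f x \<partial>a)"
  proof (rule integral_eq_if_measure_add_eq[where M = M])
    show "integrable ?U f" "integrable ?L f"
      using sets le integrable_dominated_measure[OF int(1), of ?U]
        integrable_dominated_measure[OF int(2), of ?L] by auto
    fix A assume A: "A \<in> sets M"
    have "measure ?U A + measure b A = measure ?L A + measure a A"
      using upper_minus_lower_variation[OF fin sets \<nu> A] \<nu>[OF A] by simp
    then show "emeasure ?U A + emeasure b A = emeasure ?L A + emeasure a A"
      by (simp add: U.emeasure_eq_measure L.emeasure_eq_measure a.emeasure_eq_measure
          b.emeasure_eq_measure flip: ennreal_plus)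
  qed (use sets int in auto)
  then show ?thesis
    by (simp add: signed_integral_def)
qed

section \<open>Sums of two measures\<close>

definition add_measure :: "'a measure \<Rightarrow> 'a measure \<Rightarrow> 'a measure" where
  "add_measure a b = sum_measure a (\<lambda>i. if i then a else b)"

lemma sets_add_measure [simp, measurable_cong]: "sets (add_measure a b) = sets a"
  by (simp add: add_measure_def)

lemma emeasure_add_measure:
  assumes "sets b = sets a" "A \<in> sets a"
  shows "emeasure (add_measure a b) A = emeasure a A + emeasure b A"
proof -
  have "sets (if i then a else b) = sets a" for i
    using assms by simp
  then show ?thesis
    using assms unfolding add_measure_def
    by (subst emeasure_sum_measure) (auto simp: nn_integral_count_space_finite UNIV_bool add.commute)
qed

lemma nn_integral_add_measure:
  assumes "sets b = sets a" "f \<in> borel_measurable a"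
  shows "(\<integral>\<^sup>+x. f x \<partial>add_measure a b) = (\<integral>\<^sup>+x. f x \<partial>a) + (\<integral>\<^sup>+x. f x \<partial>b)"
proof -
  have "sets (if i then a else b) = sets a" for i
    using assms by simp
  then show ?thesis
    using assms unfolding add_measure_def
    by (subst nn_integral_sum_measure) (auto simp: nn_integral_count_space_finite UNIV_bool add.commute)
qed

lemma finite_measure_add_measure:
  assumes "finite_measure a" "finite_measure b" "sets b = sets a"
  shows "finite_measure (add_measure a b)"
proof
  interpret a: finite_measure a by fact
  interpret b: finite_measure b by fact
  have "space (add_measure a b) = space a"
    by (rule sets_eq_imp_space_eq) simp
  then show "emeasure (add_measure a b) (space (add_measure a b)) \<noteq> \<infinity>"
    using assms(3) a.emeasure_finite b.emeasure_finite by (simp add: emeasure_add_measure)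
qed

lemma measure_add_measure:
  assumes "finite_measure a" "finite_measure b" "sets b = sets a" "A \<in> sets a"
  shows "measure (add_measure a b) A = measure a A + measure b A"
proof -
  interpret a: finite_measure a by fact
  interpret b: finite_measure b by fact
  show ?thesis
    unfolding measure_def using assms(3,4)
    by (simp add: emeasure_add_measure enn2real_plus less_top[symmetric])
qed

lemma integrable_add_measure:
  fixes f :: "'a \<Rightarrow> real"
  assumes "sets b = sets a" "integrable a f" "integrable b f"
  shows "integrable (add_measure a b) f"
  using assms unfolding integrable_iff_bounded
  by (auto simp: nn_integral_add_measure)

lemma integral_add_measure:
  fixes f :: "'a \<Rightarrow> real"
  assumes "sets b = sets a" "integrable a f" "integrable b f"
  shows "(\<integral>x. f x \<partial>add_measure a b) = (\<integral>x. f x \<partial>a) + (\<integral>x. f x \<partial>b)"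
  using integral_eq_if_measure_add_eq[of "add_measure a b" a "null_measure a" a b f] assms
    integrable_add_measure[OF assms]
  by (simp add: emeasure_add_measure)

section \<open>Weighted bounds and series of signed measures\<close>

lemma signed_norm_alt:
  assumes "V \<in> borel_measurable M"
  shows "signed_norm M V \<nu> =
    (\<integral>\<^sup>+x. ennreal (V x) \<partial>upper_variation M \<nu>) + (\<integral>\<^sup>+x. ennreal (V x) \<partial>lower_variation M \<nu>)"
  unfolding signed_norm_def using assms by (intro nn_integral_total_variation) auto

text \<open>Without integrability the left side is the default value 0.\<close>

lemma ennreal_abs_integral_le:
  fixes f :: "'a \<Rightarrow> real"
  shows "ennreal \<bar>\<integral>x. f x \<partial>M\<bar> \<le> (\<integral>\<^sup>+x. ennreal \<bar>f x\<bar> \<partial>M)"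
  using integral_norm_bound_ennreal[of M f]
  by (cases "integrable M f") (auto simp: not_integrable_integral_eq)

lemma nn_integral_abs_le_weight:
  fixes f V :: "'a \<Rightarrow> real"
  assumes "V \<in> borel_measurable N" "0 \<le> K" "\<And>x. x \<in> space N \<Longrightarrow> \<bar>f x\<bar> \<le> K * V x"
  shows "(\<integral>\<^sup>+x. ennreal \<bar>f x\<bar> \<partial>N) \<le> ennreal K * (\<integral>\<^sup>+x. ennreal (V x) \<partial>N)"
proof -
  have "(\<integral>\<^sup>+x. ennreal \<bar>f x\<bar> \<partial>N) \<le> (\<integral>\<^sup>+x. ennreal K * ennreal (V x) \<partial>N)"
    using assms by (intro nn_integral_mono) (auto simp: ennreal_mult'[symmetric] intro!: ennreal_leI)
  also have "\<dots> = ennreal K * (\<integral>\<^sup>+x. ennreal (V x) \<partial>N)"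
    using assms by (intro nn_integral_cmult) auto
  finally show ?thesis .
qed

lemma integrable_weight_bound:
  fixes f V :: "'a \<Rightarrow> real"
  assumes "f \<in> borel_measurable N" "V \<in> borel_measurable N" "0 \<le> K"
    and "\<And>x. x \<in> space N \<Longrightarrow> \<bar>f x\<bar> \<le> K * V x" and "(\<integral>\<^sup>+x. ennreal (V x) \<partial>N) < \<infinity>"
  shows "integrable N f"
proof -
  have "(\<integral>\<^sup>+x. ennreal \<bar>f x\<bar> \<partial>N) \<le> ennreal K * (\<integral>\<^sup>+x. ennreal (V x) \<partial>N)"
    using assms by (intro nn_integral_abs_le_weight) auto
  also have "\<dots> < \<infinity>"
    using assms(5) by (simp add: ennreal_mult_less_top)
  finally show ?thesis
    using assms by (simp add: integrable_iff_bounded)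
qed

lemma space_upper_variation [simp]: "space (upper_variation M \<nu>) = space M"
  by (rule sets_eq_imp_space_eq) simp

lemma space_lower_variation [simp]: "space (lower_variation M \<nu>) = space M"
  by (rule sets_eq_imp_space_eq) simp

text \<open>The triangle inequality over the two variations. It is available for any set function,
  since both variations are measures by construction.\<close>

lemma signed_integral_le_signed_norm:
  assumes "V \<in> borel_measurable M" "0 \<le> K" "\<And>x. x \<in> space M \<Longrightarrow> \<bar>f x\<bar> \<le> K * V x"
  shows "ennreal \<bar>signed_integral M \<nu> f\<bar> \<le> ennreal K * signed_norm M V \<nu>"
proof -
  let ?U = "upper_variation M \<nu>" and ?L = "lower_variation M \<nu>"
  have m: "V \<in> borel_measurable ?U" "V \<in> borel_measurable ?L"
    using assms(1) by (auto simp: measurable_cong_sets[OF sets_upper_variation refl]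
        measurable_cong_sets[OF sets_lower_variation refl])
  have "ennreal \<bar>signed_integral M \<nu> f\<bar> \<le> ennreal \<bar>\<integral>x. f x \<partial>?U\<bar> + ennreal \<bar>\<integral>x. f x \<partial>?L\<bar>"
    unfolding signed_integral_def using abs_triangle_ineq4 by (simp flip: ennreal_plus add: ennreal_leI)
  also have "\<dots> \<le> (\<integral>\<^sup>+x. ennreal \<bar>f x\<bar> \<partial>?U) + (\<integral>\<^sup>+x. ennreal \<bar>f x\<bar> \<partial>?L)"
    by (intro add_mono ennreal_abs_integral_le)
  also have "\<dots> \<le> ennreal K * (\<integral>\<^sup>+x. ennreal (V x) \<partial>?U) + ennreal K * (\<integral>\<^sup>+x. ennreal (V x) \<partial>?L)"
    using assms m by (intro add_mono nn_integral_abs_le_weight) auto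
  also have "\<dots> = ennreal K * signed_norm M V \<nu>"
    by (simp add: signed_norm_alt[OF assms(1)] distrib_left)
  finally show ?thesis .
qed

text \<open>Adding the upper variations and the lower variations gives two measures
  \<open>?S\<close> and \<open>?T\<close> with finite \<open>V\<close>-mass. Their difference
  represents the setwise sum \<open>R\<close>, so the integral against \<open>R\<close> splits over
  them and each part is summed term by term. The index set is unordered, so no order of summation is
  involved.\<close>

lemma signed_integral_series:
  fixes \<nu> :: "'i \<Rightarrow> 'a set \<Rightarrow> real" and f V :: "'a \<Rightarrow> real"
  assumes fin: "\<And>i. finite_measure (a i)" "\<And>i. finite_measure (b i)"
    and sets: "\<And>i. sets (a i) = sets M" "\<And>i. sets (b i) = sets M"
    and \<nu>: "\<And>i A. A \<in> sets M \<Longrightarrow> \<nu> i A = measure (a i) A - measure (b i) A"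
    and V: "V \<in> borel_measurable M" "\<And>x. x \<in> space M \<Longrightarrow> 1 \<le> V x"
    and norm: "(\<integral>\<^sup>+i. signed_norm M V (\<nu> i) \<partial>count_space UNIV) < \<infinity>"
  shows integrable_series: "A \<in> sets M \<Longrightarrow> integrable (count_space UNIV) (\<lambda>i. \<nu> i A)"
    and "\<lbrakk>\<And>A. A \<in> sets M \<Longrightarrow> R A = (\<integral>i. \<nu> i A \<partial>count_space UNIV);
      f \<in> borel_measurable M; 0 \<le> K; \<And>x. x \<in> space M \<Longrightarrow> \<bar>f x\<bar> \<le> K * V x\<rbrakk> \<Longrightarrow>
      signed_integral M R f = (\<integral>i. signed_integral M (\<nu> i) f \<partial>count_space UNIV)"
proof -
  let ?U = "\<lambda>i. upper_variation M (\<nu> i)" and ?L = "\<lambda>i. lower_variation M (\<nu> i)"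
  let ?S = "sum_measure M ?U" and ?T = "sum_measure M ?L"
  have sU: "sets (?U i) = sets M" and sL: "sets (?L i) = sets M" for i
    by simp_all
  have nnS: "g \<in> borel_measurable M \<Longrightarrow> (\<integral>\<^sup>+x. g x \<partial>?S) = (\<integral>\<^sup>+i. (\<integral>\<^sup>+x. g x \<partial>?U i) \<partial>count_space UNIV)"
    and nnT: "g \<in> borel_measurable M \<Longrightarrow> (\<integral>\<^sup>+x. g x \<partial>?T) = (\<integral>\<^sup>+i. (\<integral>\<^sup>+x. g x \<partial>?L i) \<partial>count_space UNIV)"
    for g
    by (simp_all add: nn_integral_sum_measure[OF sU] nn_integral_sum_measure[OF sL])
  have "(\<integral>\<^sup>+x. ennreal (V x) \<partial>?S) + (\<integral>\<^sup>+x. ennreal (V x) \<partial>?T) =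
      (\<integral>\<^sup>+i. signed_norm M V (\<nu> i) \<partial>count_space UNIV)"
    using V by (simp add: nnS nnT signed_norm_alt nn_integral_add)
  with norm have VS: "(\<integral>\<^sup>+x. ennreal (V x) \<partial>?S) < \<infinity>" and VT: "(\<integral>\<^sup>+x. ennreal (V x) \<partial>?T) < \<infinity>"
    by (auto simp: less_top[symmetric])
  have int: "integrable ?S g" "integrable ?T g"
    if "g \<in> borel_measurable M" "0 \<le> K" "\<And>x. x \<in> space M \<Longrightarrow> \<bar>g x\<bar> \<le> K * V x" for g :: "'a \<Rightarrow> real" and K
    using that V VS VT by (auto intro!: integrable_weight_bound[of g _ V K])
  have mixS: "integrable (count_space UNIV) (\<lambda>i. \<integral>x. g x \<partial>?U i)"
      "(\<integral>x. g x \<partial>?S) = (\<integral>i. (\<integral>x. g x \<partial>?U i) \<partial>count_space UNIV)"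
    if "integrable ?S g" for g :: "'a \<Rightarrow> real"
    by (rule integral_mixture[OF that, where N = "count_space UNIV"];
        simp add: nnS measurable_cong_sets[OF sets_sum_measure refl])+
  have mixT: "integrable (count_space UNIV) (\<lambda>i. \<integral>x. g x \<partial>?L i)"
      "(\<integral>x. g x \<partial>?T) = (\<integral>i. (\<integral>x. g x \<partial>?L i) \<partial>count_space UNIV)"
    if "integrable ?T g" for g :: "'a \<Rightarrow> real"
    by (rule integral_mixture[OF that, where N = "count_space UNIV"];
        simp add: nnT measurable_cong_sets[OF sets_sum_measure refl])+
  \<comment> \<open>Here \<open>1 \<le> V\<close> is decisive: it turns finite weighted mass into
    finite total mass.\<close>
  have ind: "integrable ?S (indicat_real A)" "integrable ?T (indicat_real A)" if "A \<in> sets M" for A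
  proof -
    have *: "\<bar>indicat_real A x\<bar> \<le> 1 * V x" if "x \<in> space M" for x
      using V(2)[OF that] by (auto simp: indicator_def)
    show "integrable ?S (indicat_real A)" "integrable ?T (indicat_real A)"
      by (rule int[where K = 1]; use that * in simp)+
  qed
  have finS: "finite_measure ?S" and finT: "finite_measure ?T"
    using ind[OF sets.top[of M]]
    by (auto intro!: finite_measureI simp: integrable_indicator_iff less_top)
  have eq: "\<nu> i A = measure (?U i) A - measure (?L i) A" if "A \<in> sets M" for i A
    using that upper_minus_lower_variation[OF fin(1)[of i] fin(2)[of i] sets(1)[of i] sets(2)[of i] \<nu>]
    by auto
  have U: "A \<in> sets M \<Longrightarrow> (\<integral>x. indicat_real A x \<partial>?U i) = measure (?U i) A"
    and L: "A \<in> sets M \<Longrightarrow> (\<integral>x. indicat_real A x \<partial>?L i) = measure (?L i) A" for i A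
    by (simp_all add: sets.Int_space_eq2)
  have intU: "integrable (count_space UNIV) (\<lambda>i. measure (?U i) A)"
    and intL: "integrable (count_space UNIV) (\<lambda>i. measure (?L i) A)" if "A \<in> sets M" for A
    using mixS(1)[OF ind(1)[OF that]] mixT(1)[OF ind(2)[OF that]] that by (simp_all add: U L sets.Int_space_eq2)
  then show "A \<in> sets M \<Longrightarrow> integrable (count_space UNIV) (\<lambda>i. \<nu> i A)"
    by (simp add: eq)
  assume R: "\<And>A. A \<in> sets M \<Longrightarrow> R A = (\<integral>i. \<nu> i A \<partial>count_space UNIV)"
    and f: "f \<in> borel_measurable M" "0 \<le> K" "\<And>x. x \<in> space M \<Longrightarrow> \<bar>f x\<bar> \<le> K * V x"
  \<comment> \<open>The pair \<open>?S\<close>, \<open>?T\<close> need not be the Jordan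
    decomposition of \<open>R\<close>, because different terms may cancel; independence of the
    representing pair makes this harmless.\<close>
  have "R A = measure ?S A - measure ?T A" if A: "A \<in> sets M" for A
  proof -
    have "measure ?S A = (\<integral>i. measure (?U i) A \<partial>count_space UNIV)"
      "measure ?T A = (\<integral>i. measure (?L i) A \<partial>count_space UNIV)"
      using mixS(2)[OF ind(1)[OF A]] mixT(2)[OF ind(2)[OF A]] A by (simp_all add: sets.Int_space_eq2)
    then show ?thesis
      using A intU intL by (simp add: R eq)
  qed
  then have "signed_integral M R f = (\<integral>x. f x \<partial>?S) - (\<integral>x. f x \<partial>?T)"
    using int[OF f] by (intro signed_integral_diff finS finT) auto
  also have "\<dots> = (\<integral>i. signed_integral M (\<nu> i) f \<partial>count_space UNIV)"
    using mixS[OF int(1)[OF f]] mixT[OF int(2)[OF f]] by (simp add: signed_integral_def)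
  finally show "signed_integral M R f = (\<integral>i. signed_integral M (\<nu> i) f \<partial>count_space UNIV)" .
qed

section \<open>Products of signed measures and double sums\<close>

lemma measure_pair_measure_alt:
  assumes "finite_measure a" "finite_measure b" "A \<in> sets (a \<Otimes>\<^sub>M b)"
  shows "measure (a \<Otimes>\<^sub>M b) A = (\<integral>x. measure b (Pair x -` A) \<partial>a)"
    and "integrable a (\<lambda>x. measure b (Pair x -` A))"
proof -
  interpret a: finite_measure a by fact
  interpret b: finite_measure b by fact
  have [measurable]: "(\<lambda>x. measure b (Pair x -` A)) \<in> borel_measurable a"
    unfolding measure_def using b.measurable_emeasure_Pair[OF assms(3)] by simp
  show "integrable a (\<lambda>x. measure b (Pair x -` A))"
    by (rule a.integrable_const_bound[where B = "measure b (space b)"]) (auto simp: b.bounded_measure)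
  then show "measure (a \<Otimes>\<^sub>M b) A = (\<integral>x. measure b (Pair x -` A) \<partial>a)"
    using assms(3) by (simp add: measure_def[of "a \<Otimes>\<^sub>M b"] b.emeasure_pair_measure_alt integral_eq_nn_integral
        b.emeasure_eq_measure)
qed

text \<open>Bilinear expansion. The slice function is a difference of bounded measurable functions,
  so its signed integral may be computed with \<open>a\<close> and \<open>a'\<close>.\<close>

lemma signed_prod_diff:
  assumes fin: "finite_measure a" "finite_measure a'" "finite_measure b" "finite_measure b'"
    and sets: "sets a = sets M" "sets a' = sets M" "sets b = sets N" "sets b' = sets N"
    and \<nu>: "\<And>A. A \<in> sets M \<Longrightarrow> \<nu> A = measure a A - measure a' A"
    and \<kappa>: "\<And>A. A \<in> sets N \<Longrightarrow> \<kappa> A = measure b A - measure b' A"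
    and A: "A \<in> sets (M \<Otimes>\<^sub>M N)"
  shows "signed_prod M \<nu> \<kappa> A = measure (a \<Otimes>\<^sub>M b) A + measure (a' \<Otimes>\<^sub>M b') A
    - (measure (a \<Otimes>\<^sub>M b') A + measure (a' \<Otimes>\<^sub>M b) A)"
proof -
  have s: "A \<in> sets (a \<Otimes>\<^sub>M b)" "A \<in> sets (a' \<Otimes>\<^sub>M b)" "A \<in> sets (a \<Otimes>\<^sub>M b')" "A \<in> sets (a' \<Otimes>\<^sub>M b')"
    using A sets by (simp_all cong: sets_pair_measure_cong)
  note alt = measure_pair_measure_alt[OF fin(1) fin(3) s(1)] measure_pair_measure_alt[OF fin(2) fin(3) s(2)]
    measure_pair_measure_alt[OF fin(1) fin(4) s(3)] measure_pair_measure_alt[OF fin(2) fin(4) s(4)]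
  have "\<kappa> (Pair x -` A) = measure b (Pair x -` A) - measure b' (Pair x -` A)" for x
    using A by (intro \<kappa> sets_Pair1)
  then have "signed_prod M \<nu> \<kappa> A = signed_integral M \<nu> (\<lambda>x. measure b (Pair x -` A) - measure b' (Pair x -` A))"
    by (simp add: signed_prod_def)
  also have "\<dots> = (\<integral>x. measure b (Pair x -` A) - measure b' (Pair x -` A) \<partial>a)
      - (\<integral>x. measure b (Pair x -` A) - measure b' (Pair x -` A) \<partial>a')"
    using alt by (intro signed_integral_diff fin sets \<nu>) auto
  also have "\<dots> = measure (a \<Otimes>\<^sub>M b) A + measure (a' \<Otimes>\<^sub>M b') A
    - (measure (a \<Otimes>\<^sub>M b') A + measure (a' \<Otimes>\<^sub>M b) A)"
    using alt by simp
  finally show ?thesis .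
qed

text \<open>Links the unordered sums used in the proof to the iterated \<open>suminf\<close> of
  \<open>Rbar2\<close>, by Fubini for counting measures.\<close>

lemma integral_count_space_prod_nat:
  fixes F :: "nat \<times> nat \<Rightarrow> real"
  assumes "integrable (count_space UNIV) F"
  shows "(\<integral>i. F i \<partial>count_space UNIV) = (\<Sum>n. \<Sum>m. F (n, m))"
    and "summable (\<lambda>n. \<Sum>m. F (n, m))" and "summable (\<lambda>m. F (n, m))"
proof -
  interpret pair_sigma_finite "count_space (UNIV :: nat set)" "count_space (UNIV :: nat set)"
    by (simp add: pair_sigma_finite_def sigma_finite_measure_count_space_countable)
  have eq: "count_space UNIV \<Otimes>\<^sub>M count_space UNIV = count_space (UNIV :: (nat \<times> nat) set)"
    by (simp add: pair_measure_countable)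
  have F: "integrable (count_space UNIV \<Otimes>\<^sub>M count_space UNIV) F"
    using assms by (simp add: eq)
  have "AE n in count_space UNIV. integrable (count_space UNIV) (\<lambda>m. F (n, m))"
    using F by (rule AE_integrable_fst')
  \<comment> \<open>Counting measure has no nonempty null sets, so almost every index means every
    index.\<close>
  then have i: "integrable (count_space UNIV) (\<lambda>m. F (n, m))" for n
    by (simp add: AE_count_space)
  then show "summable (\<lambda>m. F (n, m))"
    by (auto simp: integrable_count_space_nat_iff intro: summable_norm_cancel)
  have eq2: "(\<integral>m. F (n, m) \<partial>count_space UNIV) = (\<Sum>m. F (n, m))" for n
    by (rule integral_count_space_nat[OF i])
  have j: "integrable (count_space UNIV) (\<lambda>n. \<Sum>m. F (n, m))"
    using integrable_fst'[OF F] by (simp add: eq2)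
  then show "summable (\<lambda>n. \<Sum>m. F (n, m))"
    by (auto simp: integrable_count_space_nat_iff intro: summable_norm_cancel)
  have "(\<integral>i. F i \<partial>count_space UNIV) = (\<integral>n. (\<Sum>m. F (n, m)) \<partial>count_space UNIV)"
    using integral_fst'[OF F] by (simp add: eq eq2)
  also have "\<dots> = (\<Sum>n. \<Sum>m. F (n, m))"
    by (rule integral_count_space_nat[OF j])
  finally show "(\<integral>i. F i \<partial>count_space UNIV) = (\<Sum>n. \<Sum>m. F (n, m))" .
qed

lemma nn_integral_count_space_prod_nat:
  fixes F :: "nat \<times> nat \<Rightarrow> ennreal"
  shows "(\<integral>\<^sup>+i. F i \<partial>count_space UNIV) = (\<Sum>n. \<Sum>m. F (n, m))"
  by (simp add: nn_integral_fst_count_space[symmetric] nn_integral_count_space_nat)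

section \<open>Integrability of the weight\<close>

lemma measurable_kernel_power:
  assumes "P \<in> M \<rightarrow>\<^sub>M prob_algebra M"
  shows "kernel_power M P n \<in> M \<rightarrow>\<^sub>M prob_algebra M"
proof (induction n)
  case 0
  have "kernel_power M P 0 = return M"
    by (simp add: fun_eq_iff)
  then show ?case by simp
next
  case (Suc n)
  have "kernel_power M P (Suc n) = (\<lambda>x. P x \<bind> kernel_power M P n)"
    by (simp add: fun_eq_iff)
  then show ?case
    using measurable_bind_prob_space[OF assms Suc] by simp
qed

lemma measure_pair_measure_null:
  assumes "prob_space a" "prob_space b" "B \<in> sets (a \<Otimes>\<^sub>M b)"
    and "F \<in> sets a" "G \<in> sets b" "B \<subseteq> F \<times> G" "emeasure a F = 0 \<or> emeasure b G = 0"
  shows "measure (a \<Otimes>\<^sub>M b) B = 0"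
proof -
  interpret a: prob_space a by fact
  interpret b: prob_space b by fact
  have "emeasure (a \<Otimes>\<^sub>M b) B \<le> emeasure (a \<Otimes>\<^sub>M b) (F \<times> G)"
    using assms by (intro emeasure_mono) auto
  also have "\<dots> = 0"
    using assms by (auto simp: b.emeasure_pair_measure_Times)
  finally show ?thesis
    by (simp add: measure_def)
qed

text \<open>The level set through \<open>x\<close> is measurable and nonempty, hence the whole
  space. This serves the case where no measurable set separates two points.\<close>

lemma borel_measurable_trivial:
  fixes f :: "'a \<Rightarrow> real"
  assumes f: "f \<in> borel_measurable M" and triv: "\<And>E. E \<in> sets M \<Longrightarrow> E = {} \<or> E = space M"
    and "x \<in> space M" "y \<in> space M"
  shows "f x = f y"
proof -
  have "f -` {f x} \<inter> space M \<in> sets M"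
    using f by measurable
  then have "f -` {f x} \<inter> space M = space M"
    using triv \<open>x \<in> space M\<close> by blast
  then have "y \<in> f -` {f x}"
    using \<open>y \<in> space M\<close> by blast
  then show ?thesis by simp
qed

locale centered_kernel =
  fixes M :: "'a measure" and P :: "'a \<Rightarrow> 'a measure" and \<mu> :: "'a measure"
    and V :: "'a \<times> 'a \<Rightarrow> real" and W :: "'a \<times> 'a \<Rightarrow> real" and c :: real
  assumes P [measurable]: "P \<in> M \<rightarrow>\<^sub>M prob_algebra M"
    and \<mu>: "\<mu> \<in> space (prob_algebra M)"
    and V [measurable]: "V \<in> borel_measurable (M \<Otimes>\<^sub>M M)"
    and V_ge_1: "\<And>p. p \<in> space (M \<Otimes>\<^sub>M M) \<Longrightarrow> 1 \<le> V p"
    and C2: "\<And>x y. x \<in> space M \<Longrightarrow> y \<in> space M \<Longrightarrow>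
      (\<Sum>n. \<Sum>m. signed_norm (M \<Otimes>\<^sub>M M) V
        (signed_prod M (centered_power M P \<mu> n x) (centered_power M P \<mu> m y))) \<le> ennreal (c * W (x, y))"
begin

abbreviation "K \<equiv> kernel_power M P"

abbreviation "\<nu> n m x y \<equiv> signed_prod M (centered_power M P \<mu> n x) (centered_power M P \<mu> m y)"

lemma K [measurable]: "K n \<in> M \<rightarrow>\<^sub>M prob_algebra M"
  by (rule measurable_kernel_power[OF P])

lemma prob_K: "x \<in> space M \<Longrightarrow> prob_space (K n x)" and sets_K: "x \<in> space M \<Longrightarrow> sets (K n x) = sets M"
  using measurable_space[OF K] by (auto simp: space_prob_algebra)

lemma prob_\<mu>: "prob_space \<mu>" and sets_\<mu> [measurable_cong]: "sets \<mu> = sets M"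
  using \<mu> by (auto simp: space_prob_algebra)

lemma prob_P: "x \<in> space M \<Longrightarrow> prob_space (P x)" and sets_P: "x \<in> space M \<Longrightarrow> sets (P x) = sets M"
  using measurable_space[OF P] by (auto simp: space_prob_algebra)

lemma sets_pairs:
  assumes "x \<in> space M" "y \<in> space M"
  shows "sets (K n x \<Otimes>\<^sub>M K m y) = sets (M \<Otimes>\<^sub>M M)" "sets (K n x \<Otimes>\<^sub>M \<mu>) = sets (M \<Otimes>\<^sub>M M)"
    "sets (\<mu> \<Otimes>\<^sub>M K m y) = sets (M \<Otimes>\<^sub>M M)" "sets (\<mu> \<Otimes>\<^sub>M \<mu>) = sets (M \<Otimes>\<^sub>M M)"
  using assms by (auto intro!: sets_pair_measure_cong sets_K sets_\<mu>)

lemma prob_pairs: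
  assumes "x \<in> space M" "y \<in> space M"
  shows "prob_space (K n x \<Otimes>\<^sub>M K m y)" "prob_space (K n x \<Otimes>\<^sub>M \<mu>)"
    "prob_space (\<mu> \<Otimes>\<^sub>M K m y)" "prob_space (\<mu> \<Otimes>\<^sub>M \<mu>)"
  using assms by (auto intro!: prob_space_pair prob_K prob_\<mu>)

lemma \<nu>_eq:
  assumes "x \<in> space M" "y \<in> space M" "A \<in> sets (M \<Otimes>\<^sub>M M)"
  shows "\<nu> n m x y A = measure (K n x \<Otimes>\<^sub>M K m y) A + measure (\<mu> \<Otimes>\<^sub>M \<mu>) A
    - (measure (K n x \<Otimes>\<^sub>M \<mu>) A + measure (\<mu> \<Otimes>\<^sub>M K m y) A)"
  using assms
  by (intro signed_prod_diff)
    (auto intro: prob_space.finite_measure prob_K prob_\<mu> simp: sets_K sets_\<mu> centered_power_def)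

text \<open>The four products grouped by sign, the form in which the results on differences of
  finite measures apply.\<close>

lemma \<nu>_eq_diff:
  assumes "x \<in> space M" "y \<in> space M" "A \<in> sets (M \<Otimes>\<^sub>M M)"
  shows "\<nu> n m x y A = measure (add_measure (K n x \<Otimes>\<^sub>M K m y) (\<mu> \<Otimes>\<^sub>M \<mu>)) A
    - measure (add_measure (K n x \<Otimes>\<^sub>M \<mu>) (\<mu> \<Otimes>\<^sub>M K m y)) A"
  using assms sets_pairs[of x y] prob_pairs[of x y]
  by (simp add: \<nu>_eq measure_add_measure prob_space.finite_measure)

lemma finite_add_pairs:
  assumes "x \<in> space M" "y \<in> space M"
  shows "finite_measure (add_measure (K n x \<Otimes>\<^sub>M K m y) (\<mu> \<Otimes>\<^sub>M \<mu>))"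
    "finite_measure (add_measure (K n x \<Otimes>\<^sub>M \<mu>) (\<mu> \<Otimes>\<^sub>M K m y))"
  using assms sets_pairs[of x y] prob_pairs[of x y]
  by (simp_all add: finite_measure_add_measure prob_space.finite_measure)

lemma signed_measure_\<nu>:
  assumes "x \<in> space M" "y \<in> space M"
  shows "signed_measure (M \<Otimes>\<^sub>M M) (\<nu> n m x y)"
  using assms sets_pairs[of x y] finite_add_pairs[of x y] \<nu>_eq_diff[of x y]
  by (intro signed_measure_diff[where a = "add_measure (K n x \<Otimes>\<^sub>M K m y) (\<mu> \<Otimes>\<^sub>M \<mu>)"
      and b = "add_measure (K n x \<Otimes>\<^sub>M \<mu>) (\<mu> \<Otimes>\<^sub>M K m y)"]) auto

lemma signed_norm_finite:
  assumes "x \<in> space M" "y \<in> space M"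
  shows "signed_norm (M \<Otimes>\<^sub>M M) V (\<nu> n m x y) < \<infinity>"
proof -
  have "signed_norm (M \<Otimes>\<^sub>M M) V (\<nu> n m x y) \<le> (\<Sum>m. signed_norm (M \<Otimes>\<^sub>M M) V (\<nu> n m x y))"
    using sum_le_suminf[of "\<lambda>m. signed_norm (M \<Otimes>\<^sub>M M) V (\<nu> n m x y)" "{m}"] by simp
  also have "\<dots> \<le> (\<Sum>n. \<Sum>m. signed_norm (M \<Otimes>\<^sub>M M) V (\<nu> n m x y))"
    using sum_le_suminf[of "\<lambda>n. \<Sum>m. signed_norm (M \<Otimes>\<^sub>M M) V (\<nu> n m x y)" "{n}"] by simp
  also have "\<dots> < \<infinity>"
    using C2[OF assms] by (auto intro: le_less_trans)
  finally show ?thesis .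
qed

lemma total_variation_\<nu>_finite:
  "x \<in> space M \<Longrightarrow> y \<in> space M \<Longrightarrow> (\<integral>\<^sup>+p. ennreal (V p) \<partial>total_variation (M \<Otimes>\<^sub>M M) (\<nu> n m x y)) < \<infinity>"
  using signed_norm_finite[of x y n m] by (simp add: signed_norm_def)

text \<open>
  Condition \<open>C2\<close> only controls \<open>V\<close> against the variations of the product signed measures. If \<open>E\<close>
  separates \<open>p True\<close> from \<open>p False\<close>, then \<open>\<delta>\<^bsub>p b\<^esub> - \<mu>\<close> agrees with \<open>-\<mu>\<close> on the side not containing
  \<open>p b\<close>, so the variations dominate the unsigned products.
\<close>

lemma V_finite_nontrivial:
  assumes E: "E \<in> sets M" "E \<noteq> {}" "E \<noteq> space M" and x: "x \<in> space M" and y: "y \<in> space M"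
  shows "(\<integral>\<^sup>+p. ennreal (V p) \<partial>(\<mu> \<Otimes>\<^sub>M \<mu>)) < \<infinity>"
    and "(\<integral>\<^sup>+p. ennreal (V p) \<partial>(K n x \<Otimes>\<^sub>M \<mu>)) < \<infinity>"
    and "(\<integral>\<^sup>+p. ennreal (V p) \<partial>(\<mu> \<Otimes>\<^sub>M K m y)) < \<infinity>"
    and "(\<integral>\<^sup>+p. ennreal (V p) \<partial>(K n x \<Otimes>\<^sub>M K m y)) < \<infinity>"
proof -
  let ?MM = "M \<Otimes>\<^sub>M M"
  define F where "F b = (if b then space M - E else E)" for b
  have F [measurable]: "F b \<in> sets M" for b
    using E by (auto simp: F_def)
  have cover: "\<exists>b. z \<in> F b" if "z \<in> space M" for z
    using that by (auto simp: F_def)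
  have "\<exists>x\<in>space M. x \<notin> F b" for b
    using E sets.sets_into_space[OF E(1)] by (auto simp: F_def)
  then obtain p where p: "\<And>b. p b \<in> space M" "\<And>b. p b \<notin> F b"
    by metis
  \<comment> \<open>\<open>K 0 (p b)\<close> is the Dirac measure at \<open>p b\<close>, and
    \<open>p b\<close> lies outside \<open>F b\<close>.\<close>
  have null: "emeasure (K 0 (p b)) (F b) = 0" for b
    using p by (simp add: indicator_def)
  note [simp] = prob_pairs sets_pairs x y p(1)
  have em: "prob_space N \<Longrightarrow> emeasure N A = ennreal (measure N A)" for N and A :: "('a \<times> 'a) set"
    by (simp add: finite_measure.emeasure_eq_measure prob_space.finite_measure)
  have TV: "\<bar>\<nu> n m x y A\<bar> \<le> emeasure (total_variation ?MM (\<nu> n m x y)) A"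
    if "A \<in> sets ?MM" "x \<in> space M" "y \<in> space M" for n m x y A
    using that by (intro abs_le_total_variation signed_measure_\<nu>) auto
  have TV_mono: "emeasure (total_variation ?MM (\<nu> n m x y)) B \<le> emeasure (total_variation ?MM (\<nu> n m x y)) A"
    if "B \<subseteq> A" "A \<in> sets ?MM" for n m x y A B
    using that by (intro emeasure_mono) auto
  have sub: "A \<in> sets ?MM \<Longrightarrow> A \<subseteq> space M \<times> space M" for A
    using sets.sets_into_space[of A ?MM] by (simp add: space_pair_measure)
  have left0: "measure (K 0 (p b) \<Otimes>\<^sub>M N) B = 0"
    if "prob_space N" "sets N = sets M" "B \<in> sets ?MM" "B \<subseteq> F b \<times> space M" for b B N
    using that by (intro measure_pair_measure_null[where F = "F b" and G = "space M"] prob_K null disjI1)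
      (auto simp del: kernel_power.simps simp: sets_K cong: sets_pair_measure_cong)
  have right0: "measure (N \<Otimes>\<^sub>M K 0 (p b)) B = 0"
    if "prob_space N" "sets N = sets M" "B \<in> sets ?MM" "B \<subseteq> space M \<times> F b" for b B N
    using that by (intro measure_pair_measure_null[where G = "F b" and F = "space M"] prob_K null disjI2)
      (auto simp del: kernel_power.simps simp: sets_K cong: sets_pair_measure_cong)

  \<comment> \<open>On \<open>F b \<times> F c\<close> every product with a Dirac factor vanishes,
    so the centred product started at \<open>p b\<close> and \<open>p c\<close> coincides there with
    \<open>\<mu> \<Otimes>\<^sub>M \<mu>\<close>. The four rectangles cover the space.\<close>
  show 1: "(\<integral>\<^sup>+p. ennreal (V p) \<partial>(\<mu> \<Otimes>\<^sub>M \<mu>)) < \<infinity>"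
  proof (rule nn_integral_dominated_finite[where M = ?MM and
        \<kappa> = "\<lambda>(b, c). total_variation ?MM (\<nu> 0 0 (p b) (p c))"])
    fix A assume A: "A \<in> sets ?MM"
    have "z \<in> (\<Union>i\<in>UNIV. A \<inter> F (fst i) \<times> F (snd i))" if "z \<in> A" for z
    proof -
      have "z \<in> space M \<times> space M"
        using sub[OF A] that by (rule subsetD)
      then obtain b c where "fst z \<in> F b" "snd z \<in> F c"
        using cover[of "fst z"] cover[of "snd z"] by (auto simp: mem_Times_iff)
      then show ?thesis
        using that by (intro UN_I[of "(b, c)"]) (auto simp: mem_Times_iff)
    qed
    then have "A = (\<Union>i\<in>UNIV. A \<inter> F (fst i) \<times> F (snd i))"
      by auto
    then have "emeasure (\<mu> \<Otimes>\<^sub>M \<mu>) A = emeasure (\<mu> \<Otimes>\<^sub>M \<mu>) (\<Union>i\<in>UNIV. A \<inter> F (fst i) \<times> F (snd i))"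
      by (rule arg_cong)
    also have "\<dots> \<le> (\<Sum>i\<in>UNIV. emeasure (\<mu> \<Otimes>\<^sub>M \<mu>) (A \<inter> F (fst i) \<times> F (snd i)))"
      using A F by (intro emeasure_subadditive_finite) auto
    also have "\<dots> \<le> (\<Sum>i\<in>UNIV. emeasure (total_variation ?MM (\<nu> 0 0 (p (fst i)) (p (snd i)))) A)"
    proof (rule sum_mono)
      fix i :: "bool \<times> bool"
      let ?B = "A \<inter> F (fst i) \<times> F (snd i)"
      have B: "?B \<in> sets ?MM" "?B \<subseteq> F (fst i) \<times> space M" "?B \<subseteq> space M \<times> F (snd i)"
        using A F sub[OF A] by auto
      have "\<nu> 0 0 (p (fst i)) (p (snd i)) ?B = measure (\<mu> \<Otimes>\<^sub>M \<mu>) ?B"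
        using B left0[OF prob_K[OF p(1)] sets_K[OF p(1)] B(1,2)] left0[OF prob_\<mu> sets_\<mu> B(1,2)]
          right0[OF prob_\<mu> sets_\<mu> B(1,3)]
        by (subst \<nu>_eq) (simp_all del: kernel_power.simps)
      then have "emeasure (\<mu> \<Otimes>\<^sub>M \<mu>) ?B = ennreal \<bar>\<nu> 0 0 (p (fst i)) (p (snd i)) ?B\<bar>"
        using prob_pairs[OF x x] by (simp add: em)
      also have "\<dots> \<le> emeasure (total_variation ?MM (\<nu> 0 0 (p (fst i)) (p (snd i)))) ?B"
        using B by (intro TV) auto
      also have "\<dots> \<le> emeasure (total_variation ?MM (\<nu> 0 0 (p (fst i)) (p (snd i)))) A"
        using A by (intro TV_mono) auto
      finally show "emeasure (\<mu> \<Otimes>\<^sub>M \<mu>) ?B \<le> \<dots>" .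
    qed
    finally show "emeasure (\<mu> \<Otimes>\<^sub>M \<mu>) A \<le>
        (\<Sum>i\<in>UNIV. emeasure (case i of (b, c) \<Rightarrow> total_variation ?MM (\<nu> 0 0 (p b) (p c))) A)"
      by (simp add: split_beta)
  qed (use sets_pairs[OF x x] in \<open>auto simp: total_variation_\<nu>_finite[unfolded infinity_ennreal_def] simp del: kernel_power.simps split: if_splits\<close>)

  \<comment> \<open>On the strip \<open>space M \<times> F b\<close> the Dirac measure in the second
    factor vanishes, so the centred product is \<open>\<mu> \<Otimes>\<^sub>M \<mu>\<close> minus
    \<open>K n x \<Otimes>\<^sub>M \<mu>\<close>. The first part is already controlled. Each of the
    two strips contributes one total variation and one copy of
    \<open>\<mu> \<Otimes>\<^sub>M \<mu>\<close>, whence four indices.\<close>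
  show 2: "(\<integral>\<^sup>+p. ennreal (V p) \<partial>(K n x \<Otimes>\<^sub>M \<mu>)) < \<infinity>" for n
  proof (rule nn_integral_dominated_finite[where M = ?MM and
        \<kappa> = "\<lambda>(b, d). if d then total_variation ?MM (\<nu> n 0 x (p b)) else \<mu> \<Otimes>\<^sub>M \<mu>"])
    fix A assume A: "A \<in> sets ?MM"
    have "z \<in> (\<Union>b. A \<inter> space M \<times> F b)" if "z \<in> A" for z
    proof -
      have z: "z \<in> space M \<times> space M"
        using sub[OF A] that by (rule subsetD)
      then obtain b where "snd z \<in> F b"
        using cover[of "snd z"] by (auto simp: mem_Times_iff)
      with z that show ?thesis
        by (intro UN_I[of b]) (auto simp: mem_Times_iff)
    qed
    then have "A = (\<Union>b. A \<inter> space M \<times> F b)"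
      by auto
    then have "emeasure (K n x \<Otimes>\<^sub>M \<mu>) A = emeasure (K n x \<Otimes>\<^sub>M \<mu>) (\<Union>b\<in>UNIV. A \<inter> space M \<times> F b)"
      by (rule arg_cong)
    also have "\<dots> \<le> (\<Sum>b\<in>UNIV. emeasure (K n x \<Otimes>\<^sub>M \<mu>) (A \<inter> space M \<times> F b))"
      using A F sets_pairs[OF x x] by (intro emeasure_subadditive_finite) auto
    also have "\<dots> \<le> (\<Sum>b\<in>UNIV. emeasure (total_variation ?MM (\<nu> n 0 x (p b))) A + emeasure (\<mu> \<Otimes>\<^sub>M \<mu>) A)"
    proof (rule sum_mono)
      fix b :: bool
      let ?B = "A \<inter> space M \<times> F b"
      have B: "?B \<in> sets ?MM" "?B \<subseteq> space M \<times> F b"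
        using A F by auto
      have "\<nu> n 0 x (p b) ?B = measure (\<mu> \<Otimes>\<^sub>M \<mu>) ?B - measure (K n x \<Otimes>\<^sub>M \<mu>) ?B"
        using B right0[OF prob_K[OF x] sets_K[OF x] B] right0[OF prob_\<mu> sets_\<mu> B]
        by (subst \<nu>_eq) (simp_all del: kernel_power.simps)
      then have "measure (K n x \<Otimes>\<^sub>M \<mu>) ?B \<le> \<bar>\<nu> n 0 x (p b) ?B\<bar> + measure (\<mu> \<Otimes>\<^sub>M \<mu>) ?B"
        by linarith
      then have "emeasure (K n x \<Otimes>\<^sub>M \<mu>) ?B \<le> ennreal \<bar>\<nu> n 0 x (p b) ?B\<bar> + emeasure (\<mu> \<Otimes>\<^sub>M \<mu>) ?B"
        using prob_pairs[OF x x] by (simp add: em ennreal_leI flip: ennreal_plus)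
      also have "\<dots> \<le> emeasure (total_variation ?MM (\<nu> n 0 x (p b))) ?B + emeasure (\<mu> \<Otimes>\<^sub>M \<mu>) ?B"
        using B by (intro TV add_mono order_refl) auto
      also have "\<dots> \<le> emeasure (total_variation ?MM (\<nu> n 0 x (p b))) A + emeasure (\<mu> \<Otimes>\<^sub>M \<mu>) A"
        using A sets_pairs[OF x x] by (intro TV_mono emeasure_mono add_mono) auto
      finally show "emeasure (K n x \<Otimes>\<^sub>M \<mu>) ?B \<le> \<dots>" .
    qed
    also have "\<dots> = (\<Sum>i\<in>UNIV. emeasure (case i of (b, d) \<Rightarrow>
        if d then total_variation ?MM (\<nu> n 0 x (p b)) else \<mu> \<Otimes>\<^sub>M \<mu>) A)"
      by (simp add: UNIV_Times_UNIV[symmetric] UNIV_bool add_ac del: UNIV_Times_UNIV kernel_power.simps)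
    finally show "emeasure (K n x \<Otimes>\<^sub>M \<mu>) A \<le> \<dots>" .
  qed (use sets_pairs[OF x x] 1 in \<open>auto simp: total_variation_\<nu>_finite[unfolded infinity_ennreal_def] simp del: kernel_power.simps split: if_splits\<close>)

  \<comment> \<open>The mirror image, with the Dirac measure in the first factor.\<close>
  show 3: "(\<integral>\<^sup>+p. ennreal (V p) \<partial>(\<mu> \<Otimes>\<^sub>M K m y)) < \<infinity>" for m
  proof (rule nn_integral_dominated_finite[where M = ?MM and
        \<kappa> = "\<lambda>(b, d). if d then total_variation ?MM (\<nu> 0 m (p b) y) else \<mu> \<Otimes>\<^sub>M \<mu>"])
    fix A assume A: "A \<in> sets ?MM"
    have "z \<in> (\<Union>b. A \<inter> F b \<times> space M)" if "z \<in> A" for z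
    proof -
      have z: "z \<in> space M \<times> space M"
        using sub[OF A] that by (rule subsetD)
      then obtain b where "fst z \<in> F b"
        using cover[of "fst z"] by (auto simp: mem_Times_iff)
      with z that show ?thesis
        by (intro UN_I[of b]) (auto simp: mem_Times_iff)
    qed
    then have "A = (\<Union>b. A \<inter> F b \<times> space M)"
      by auto
    then have "emeasure (\<mu> \<Otimes>\<^sub>M K m y) A = emeasure (\<mu> \<Otimes>\<^sub>M K m y) (\<Union>b\<in>UNIV. A \<inter> F b \<times> space M)"
      by (rule arg_cong)
    also have "\<dots> \<le> (\<Sum>b\<in>UNIV. emeasure (\<mu> \<Otimes>\<^sub>M K m y) (A \<inter> F b \<times> space M))"
      using A F sets_pairs[OF y y] by (intro emeasure_subadditive_finite) auto
    also have "\<dots> \<le> (\<Sum>b\<in>UNIV. emeasure (total_variation ?MM (\<nu> 0 m (p b) y)) A + emeasure (\<mu> \<Otimes>\<^sub>M \<mu>) A)"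
    proof (rule sum_mono)
      fix b :: bool
      let ?B = "A \<inter> F b \<times> space M"
      have B: "?B \<in> sets ?MM" "?B \<subseteq> F b \<times> space M"
        using A F by auto
      have "\<nu> 0 m (p b) y ?B = measure (\<mu> \<Otimes>\<^sub>M \<mu>) ?B - measure (\<mu> \<Otimes>\<^sub>M K m y) ?B"
        using B left0[OF prob_K[OF y] sets_K[OF y] B] left0[OF prob_\<mu> sets_\<mu> B]
        by (subst \<nu>_eq) (simp_all del: kernel_power.simps)
      then have "measure (\<mu> \<Otimes>\<^sub>M K m y) ?B \<le> \<bar>\<nu> 0 m (p b) y ?B\<bar> + measure (\<mu> \<Otimes>\<^sub>M \<mu>) ?B"
        by linarith
      then have "emeasure (\<mu> \<Otimes>\<^sub>M K m y) ?B \<le> ennreal \<bar>\<nu> 0 m (p b) y ?B\<bar> + emeasure (\<mu> \<Otimes>\<^sub>M \<mu>) ?B"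
        using prob_pairs[OF y y] by (simp add: em ennreal_leI flip: ennreal_plus)
      also have "\<dots> \<le> emeasure (total_variation ?MM (\<nu> 0 m (p b) y)) ?B + emeasure (\<mu> \<Otimes>\<^sub>M \<mu>) ?B"
        using B by (intro TV add_mono order_refl) auto
      also have "\<dots> \<le> emeasure (total_variation ?MM (\<nu> 0 m (p b) y)) A + emeasure (\<mu> \<Otimes>\<^sub>M \<mu>) A"
        using A sets_pairs[OF y y] by (intro TV_mono emeasure_mono add_mono) auto
      finally show "emeasure (\<mu> \<Otimes>\<^sub>M K m y) ?B \<le> \<dots>" .
    qed
    also have "\<dots> = (\<Sum>i\<in>UNIV. emeasure (case i of (b, d) \<Rightarrow>
        if d then total_variation ?MM (\<nu> 0 m (p b) y) else \<mu> \<Otimes>\<^sub>M \<mu>) A)"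
      by (simp add: UNIV_Times_UNIV[symmetric] UNIV_bool add_ac del: UNIV_Times_UNIV kernel_power.simps)
    finally show "emeasure (\<mu> \<Otimes>\<^sub>M K m y) A \<le> \<dots>" .
  qed (use sets_pairs[OF y y] 1 in \<open>auto simp: total_variation_\<nu>_finite[unfolded infinity_ennreal_def] simp del: kernel_power.simps split: if_splits\<close>)

  show "(\<integral>\<^sup>+p. ennreal (V p) \<partial>(K n x \<Otimes>\<^sub>M K m y)) < \<infinity>"
  proof (rule nn_integral_dominated_finite[where M = ?MM and
        \<kappa> = "\<lambda>(b, d). if b then if d then K n x \<Otimes>\<^sub>M \<mu> else \<mu> \<Otimes>\<^sub>M K m y
          else total_variation ?MM (\<nu> n m x y)"])
    fix A assume A: "A \<in> sets ?MM"
    let ?T = "emeasure (total_variation ?MM (\<nu> n m x y)) A"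
    have "measure (K n x \<Otimes>\<^sub>M K m y) A \<le>
        \<bar>\<nu> n m x y A\<bar> + (measure (K n x \<Otimes>\<^sub>M \<mu>) A + measure (\<mu> \<Otimes>\<^sub>M K m y) A)"
      using \<nu>_eq[OF x y A, of n m] measure_nonneg[of "\<mu> \<Otimes>\<^sub>M \<mu>" A] by linarith
    then have "emeasure (K n x \<Otimes>\<^sub>M K m y) A \<le>
        ennreal \<bar>\<nu> n m x y A\<bar> + (emeasure (K n x \<Otimes>\<^sub>M \<mu>) A + emeasure (\<mu> \<Otimes>\<^sub>M K m y) A)"
      using prob_pairs[OF x y] by (simp add: em ennreal_leI flip: ennreal_plus)
    \<comment> \<open>The total variation is counted twice because the indices
      \<open>(False, d)\<close> both carry it.\<close>
    also have "\<dots> \<le> (?T + ?T) + (emeasure (K n x \<Otimes>\<^sub>M \<mu>) A + emeasure (\<mu> \<Otimes>\<^sub>M K m y) A)"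
      using TV[OF A x y, of n m] by (intro add_right_mono) (auto intro: order_trans add_increasing)
    also have "\<dots> = (\<Sum>i\<in>UNIV. emeasure (case i of (b, d) \<Rightarrow>
        if b then if d then K n x \<Otimes>\<^sub>M \<mu> else \<mu> \<Otimes>\<^sub>M K m y else total_variation ?MM (\<nu> n m x y)) A)"
      by (simp add: UNIV_Times_UNIV[symmetric] UNIV_bool add_ac del: UNIV_Times_UNIV)
    finally show "emeasure (K n x \<Otimes>\<^sub>M K m y) A \<le> \<dots>" .
  qed (use sets_pairs[OF x y] 2 3 in \<open>auto simp: total_variation_\<nu>_finite[unfolded infinity_ennreal_def] split: if_splits\<close>)
qed

text \<open>If the sigma-algebra is trivial there is no separating set, but then \<open>V\<close> is
  constant and integrable against every probability measure.\<close>

lemma V_finite: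
  assumes x: "x \<in> space M" and y: "y \<in> space M"
  shows "(\<integral>\<^sup>+p. ennreal (V p) \<partial>(\<mu> \<Otimes>\<^sub>M \<mu>)) < \<infinity>"
    and "(\<integral>\<^sup>+p. ennreal (V p) \<partial>(K n x \<Otimes>\<^sub>M \<mu>)) < \<infinity>"
    and "(\<integral>\<^sup>+p. ennreal (V p) \<partial>(\<mu> \<Otimes>\<^sub>M K m y)) < \<infinity>"
    and "(\<integral>\<^sup>+p. ennreal (V p) \<partial>(K n x \<Otimes>\<^sub>M K m y)) < \<infinity>"
proof -
  have triv: "(\<integral>\<^sup>+p. ennreal (V p) \<partial>N) < \<infinity>"
    if triv: "\<And>E. E \<in> sets M \<Longrightarrow> E = {} \<or> E = space M" and N: "prob_space N" "sets N = sets (M \<Otimes>\<^sub>M M)" for N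
  proof -
    have "V p = V (x, y)" if "p \<in> space N" for p
    proof -
      have p: "fst p \<in> space M" "snd p \<in> space M"
        using that unfolding sets_eq_imp_space_eq[OF N(2)] by (auto simp: space_pair_measure)
      have "V (fst p, snd p) = V (x, snd p)"
        using p(2) by (intro borel_measurable_trivial[OF _ triv p(1) x]) measurable
      also have "\<dots> = V (x, y)"
        using x by (intro borel_measurable_trivial[OF _ triv p(2) y]) measurable
      finally show ?thesis by simp
    qed
    then have "(\<integral>\<^sup>+p. ennreal (V p) \<partial>N) = (\<integral>\<^sup>+p. ennreal (V (x, y)) \<partial>N)"
      by (intro nn_integral_cong) simp
    then show ?thesis
      using prob_space.emeasure_space_1[OF N(1)] by simp
  qed
  have "(\<integral>\<^sup>+p. ennreal (V p) \<partial>(\<mu> \<Otimes>\<^sub>M \<mu>)) < \<infinity> \<and> (\<integral>\<^sup>+p. ennreal (V p) \<partial>(K n x \<Otimes>\<^sub>M \<mu>)) < \<infinity> \<and>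
    (\<integral>\<^sup>+p. ennreal (V p) \<partial>(\<mu> \<Otimes>\<^sub>M K m y)) < \<infinity> \<and> (\<integral>\<^sup>+p. ennreal (V p) \<partial>(K n x \<Otimes>\<^sub>M K m y)) < \<infinity>"
  proof (cases "\<exists>E\<in>sets M. E \<noteq> {} \<and> E \<noteq> space M")
    case True
    then obtain E where E: "E \<in> sets M" "E \<noteq> {}" "E \<noteq> space M" by blast
    show ?thesis
      by (intro conjI V_finite_nontrivial[OF E x y])
  next
    case False
    then have "\<And>E. E \<in> sets M \<Longrightarrow> E = {} \<or> E = space M" by blast
    note t = triv[OF this]
    show ?thesis
      by (intro conjI t prob_pairs[OF x y] sets_pairs[OF x y])
  qed
  then show "(\<integral>\<^sup>+p. ennreal (V p) \<partial>(\<mu> \<Otimes>\<^sub>M \<mu>)) < \<infinity>"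
    "(\<integral>\<^sup>+p. ennreal (V p) \<partial>(K n x \<Otimes>\<^sub>M \<mu>)) < \<infinity>"
    "(\<integral>\<^sup>+p. ennreal (V p) \<partial>(\<mu> \<Otimes>\<^sub>M K m y)) < \<infinity>"
    "(\<integral>\<^sup>+p. ennreal (V p) \<partial>(K n x \<Otimes>\<^sub>M K m y)) < \<infinity>"
    by auto
qed

end

section \<open>The Poisson equation\<close>

lemma integrable_count_space_inj:
  fixes F :: "'i \<Rightarrow> real" and g :: "'j \<Rightarrow> 'i"
  assumes "integrable (count_space UNIV) F" "inj g"
  shows "integrable (count_space UNIV) (\<lambda>i. F (g i))"
proof -
  have "Infinite_Set_Sum.abs_summable_on F (range g)"
    using assms(1) Infinite_Set_Sum.abs_summable_on_subset[of F UNIV "range g"]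
    by (simp add: Infinite_Set_Sum.abs_summable_on_def)
  then show ?thesis
    using Infinite_Set_Sum.abs_summable_on_reindex_iff[OF assms(2), of F]
    by (simp add: Infinite_Set_Sum.abs_summable_on_def)
qed

lemma integral_count_space_swap:
  fixes F :: "'i \<Rightarrow> 'j \<Rightarrow> real"
  shows "(\<integral>i. F (fst i) (snd i) \<partial>count_space UNIV) = (\<integral>i. F (snd i) (fst i) \<partial>count_space UNIV)"
  using integral_bij_count_space[of prod.swap UNIV UNIV "\<lambda>i. F (fst i) (snd i)"]
  by (simp add: bij_swap)

text \<open>Dropping the first row from the full series and from the series without first column
  leaves two copies of row 0, one of them without its first entry. Their difference is the
  corner.\<close>

lemma double_series_inclusion_exclusion:
  fixes F :: "nat \<Rightarrow> nat \<Rightarrow> real"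
  assumes "integrable (count_space UNIV) (\<lambda>i. F (fst i) (snd i))"
  shows "F 0 0 = (\<integral>i. F (fst i) (snd i) \<partial>count_space UNIV)
    - (\<integral>i. F (Suc (fst i)) (snd i) \<partial>count_space UNIV)
    - (\<integral>i. F (fst i) (Suc (snd i)) \<partial>count_space UNIV)
    + (\<integral>i. F (Suc (fst i)) (Suc (snd i)) \<partial>count_space UNIV)"
proof -
  have int: "integrable (count_space UNIV) (\<lambda>i. F (fst i + k) (snd i + l))" for k l
    using integrable_count_space_inj[OF assms, of "\<lambda>i. (fst i + k, snd i + l)"]
    by (simp add: inj_def prod_eq_iff)
  note s = integral_count_space_prod_nat[OF int]
  note s00 = s[of 0 0, simplified] and s10 = s[of "Suc 0" 0, simplified]
    and s01 = s[of 0 "Suc 0", simplified] and s11 = s[of "Suc 0" "Suc 0", simplified]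
  have "(\<Sum>n. \<Sum>m. F (Suc n) m) = (\<Sum>n. \<Sum>m. F n m) - (\<Sum>m. F 0 m)"
    by (rule suminf_split_head[OF s00(2)])
  moreover have "(\<Sum>n. \<Sum>m. F (Suc n) (Suc m)) = (\<Sum>n. \<Sum>m. F n (Suc m)) - (\<Sum>m. F 0 (Suc m))"
    by (rule suminf_split_head[OF s01(2)])
  moreover have "(\<Sum>m. F 0 (Suc m)) = (\<Sum>m. F 0 m) - F 0 0"
    by (rule suminf_split_head[OF s00(3)])
  ultimately show ?thesis
    using s00(1) s10(1) s01(1) s11(1) by simp
qed

text \<open>The function \<open>f\<close> stands for \<open>hbar2 \<mu> (h n)\<close> and
  \<open>L\<close> for a bound on its weighted norm; the Poisson equation is derived from the bound,
  the symmetry and the degeneracy alone.\<close>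

locale degenerate_function = centered_kernel +
  fixes f :: "'a \<times> 'a \<Rightarrow> real" and L :: real
  assumes c_nonneg: "0 \<le> c" and L_nonneg: "0 \<le> L"
    and W [measurable]: "W \<in> borel_measurable (M \<Otimes>\<^sub>M M)"
    and W_sym: "\<And>x y. x \<in> space M \<Longrightarrow> y \<in> space M \<Longrightarrow> W (x, y) = W (y, x)"
    and PW: "\<And>x y. x \<in> space M \<Longrightarrow> y \<in> space M \<Longrightarrow> (\<integral>\<^sup>+z. ennreal (W (z, y)) \<partial>P x) < \<infinity>"
    and PPW: "\<And>x y. x \<in> space M \<Longrightarrow> y \<in> space M \<Longrightarrow>
      (\<integral>\<^sup>+z\<^sub>1. (\<integral>\<^sup>+z\<^sub>2. ennreal (W (z\<^sub>1, z\<^sub>2)) \<partial>P y) \<partial>P x) < \<infinity>"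
    and f [measurable]: "f \<in> borel_measurable (M \<Otimes>\<^sub>M M)"
    and f_bound: "\<And>p. p \<in> space (M \<Otimes>\<^sub>M M) \<Longrightarrow> \<bar>f p\<bar> \<le> L * V p"
    and f_sym: "\<And>x y. x \<in> space M \<Longrightarrow> y \<in> space M \<Longrightarrow> f (x, y) = f (y, x)"
    and f_degenerate: "\<And>x. x \<in> space M \<Longrightarrow> (\<integral>y. f (x, y) \<partial>\<mu>) = 0"
begin

abbreviation "C \<equiv> count_space (UNIV :: (nat \<times> nat) set)"

definition T :: "nat \<Rightarrow> nat \<Rightarrow> 'a \<Rightarrow> 'a \<Rightarrow> real" where
  "T n m x y = (\<integral>p. f p \<partial>(K n x \<Otimes>\<^sub>M K m y))"

lemma space_K: "x \<in> space M \<Longrightarrow> space (K n x) = space M"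
  using sets_K by (rule sets_eq_imp_space_eq)

lemma space_P: "x \<in> space M \<Longrightarrow> space (P x) = space M"
  using sets_P by (rule sets_eq_imp_space_eq)

lemma pair_sigma_finite_prob: "prob_space a \<Longrightarrow> prob_space b \<Longrightarrow> pair_sigma_finite a b"
  by (simp add: pair_sigma_finite_def prob_space_imp_sigma_finite)

lemma integrable_f:
  assumes "x \<in> space M" "y \<in> space M"
  shows "integrable (K n x \<Otimes>\<^sub>M K m y) f" "integrable (K n x \<Otimes>\<^sub>M \<mu>) f"
    "integrable (\<mu> \<Otimes>\<^sub>M K m y) f" "integrable (\<mu> \<Otimes>\<^sub>M \<mu>) f"
proof -
  have "integrable N f" if "sets N = sets (M \<Otimes>\<^sub>M M)" "(\<integral>\<^sup>+p. ennreal (V p) \<partial>N) < \<infinity>" for N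
    using that f_bound L_nonneg sets_eq_imp_space_eq[OF that(1)]
    by (intro integrable_weight_bound[of f N V L]) (simp_all add: measurable_cong_sets[OF that(1) refl])
  then show "integrable (K n x \<Otimes>\<^sub>M K m y) f" "integrable (K n x \<Otimes>\<^sub>M \<mu>) f"
    "integrable (\<mu> \<Otimes>\<^sub>M K m y) f" "integrable (\<mu> \<Otimes>\<^sub>M \<mu>) f"
    using assms V_finite[OF assms] sets_pairs[OF assms] by auto
qed

text \<open>Degeneracy is assumed in the second coordinate; symmetry of \<open>f\<close> carries it
  over to the first.\<close>

lemma integral_f_\<mu>:
  assumes "prob_space a" "sets a = sets M"
  shows "integrable (a \<Otimes>\<^sub>M \<mu>) f \<Longrightarrow> (\<integral>p. f p \<partial>(a \<Otimes>\<^sub>M \<mu>)) = 0"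
    and "integrable (\<mu> \<Otimes>\<^sub>M a) f \<Longrightarrow> (\<integral>p. f p \<partial>(\<mu> \<Otimes>\<^sub>M a)) = 0"
proof -
  interpret l: pair_sigma_finite a \<mu>
    using assms prob_\<mu> by (intro pair_sigma_finite_prob)
  interpret r: pair_sigma_finite \<mu> a
    using assms prob_\<mu> by (intro pair_sigma_finite_prob)
  have sp: "space a = space M" "space \<mu> = space M"
    by (rule sets_eq_imp_space_eq[OF assms(2)], rule sets_eq_imp_space_eq[OF sets_\<mu>])
  show "(\<integral>p. f p \<partial>(a \<Otimes>\<^sub>M \<mu>)) = 0" if "integrable (a \<Otimes>\<^sub>M \<mu>) f"
  proof -
    have "(\<integral>p. f p \<partial>(a \<Otimes>\<^sub>M \<mu>)) = (\<integral>x. (\<integral>y. f (x, y) \<partial>\<mu>) \<partial>a)"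
      using l.integral_fst'[OF that] by simp
    also have "\<dots> = (\<integral>x. 0 \<partial>a)"
      using sp by (intro Bochner_Integration.integral_cong) (auto simp: f_degenerate)
    finally show ?thesis by simp
  qed
  show "(\<integral>p. f p \<partial>(\<mu> \<Otimes>\<^sub>M a)) = 0" if "integrable (\<mu> \<Otimes>\<^sub>M a) f"
  proof -
    have "(\<integral>p. f p \<partial>(\<mu> \<Otimes>\<^sub>M a)) = (\<integral>y. (\<integral>x. f (x, y) \<partial>\<mu>) \<partial>a)"
      using r.integral_snd[of "\<lambda>x y. f (x, y)"] that by simp
    also have "\<dots> = (\<integral>y. (\<integral>x. f (y, x) \<partial>\<mu>) \<partial>a)"
      using sp by (intro Bochner_Integration.integral_cong refl) (auto intro: f_sym)
    also have "\<dots> = (\<integral>y. 0 \<partial>a)"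
      using sp by (intro Bochner_Integration.integral_cong) (auto simp: f_degenerate)
    finally show ?thesis by simp
  qed
qed

lemma signed_integral_\<nu>:
  assumes xy: "x \<in> space M" "y \<in> space M"
  shows "signed_integral (M \<Otimes>\<^sub>M M) (\<nu> n m x y) f = T n m x y"
proof -
  note s = sets_pairs[OF xy] and i = integrable_f[OF xy]
  have "signed_integral (M \<Otimes>\<^sub>M M) (\<nu> n m x y) f =
      (\<integral>p. f p \<partial>add_measure (K n x \<Otimes>\<^sub>M K m y) (\<mu> \<Otimes>\<^sub>M \<mu>)) - (\<integral>p. f p \<partial>add_measure (K n x \<Otimes>\<^sub>M \<mu>) (\<mu> \<Otimes>\<^sub>M K m y))"
    by (intro signed_integral_diff finite_add_pairs[OF xy] \<nu>_eq_diff[OF xy] integrable_add_measure i)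
      (auto simp: s)
  also have "\<dots> = ((\<integral>p. f p \<partial>(K n x \<Otimes>\<^sub>M K m y)) + (\<integral>p. f p \<partial>(\<mu> \<Otimes>\<^sub>M \<mu>)))
      - ((\<integral>p. f p \<partial>(K n x \<Otimes>\<^sub>M \<mu>)) + (\<integral>p. f p \<partial>(\<mu> \<Otimes>\<^sub>M K m y)))"
    by (subst (1 2) integral_add_measure) (auto simp: s i)
  also have "\<dots> = T n m x y"
    using i prob_K[OF xy(1)] prob_K[OF xy(2)] sets_K[OF xy(1)] sets_K[OF xy(2)] prob_\<mu> sets_\<mu>
    by (simp add: integral_f_\<mu> T_def)
  finally show ?thesis .
qed

text \<open>Each term is at most \<open>L\<close> times the \<open>V\<close>-norm of its centred
  product, and C2 sums these norms. This is the dominating bound behind all later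
  interchanges.\<close>

lemma nn_integral_T:
  assumes xy: "x \<in> space M" "y \<in> space M"
  shows "(\<integral>\<^sup>+i. ennreal \<bar>T (fst i) (snd i) x y\<bar> \<partial>C) \<le> ennreal L * (ennreal c * ennreal (W (x, y)))"
proof -
  have "(\<integral>\<^sup>+i. ennreal \<bar>T (fst i) (snd i) x y\<bar> \<partial>C) \<le>
      (\<integral>\<^sup>+i. ennreal L * signed_norm (M \<Otimes>\<^sub>M M) V (\<nu> (fst i) (snd i) x y) \<partial>C)"
    unfolding signed_integral_\<nu>[OF xy, symmetric]
    by (intro nn_integral_mono signed_integral_le_signed_norm V L_nonneg f_bound)
  also have "\<dots> = ennreal L * (\<Sum>n. \<Sum>m. signed_norm (M \<Otimes>\<^sub>M M) V (\<nu> n m x y))"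
    by (simp add: nn_integral_cmult nn_integral_count_space_prod_nat)
  also have "\<dots> \<le> ennreal L * ennreal (c * W (x, y))"
    by (intro mult_left_mono C2[OF xy]) simp
  finally show ?thesis
    using c_nonneg by (simp add: ennreal_mult')
qed

lemma integrable_T:
  assumes xy: "x \<in> space M" "y \<in> space M"
  shows "integrable C (\<lambda>i. T (fst i) (snd i) x y)"
  using nn_integral_T[OF xy]
  by (auto simp: integrable_iff_bounded ennreal_mult_less_top intro: le_less_trans)

text \<open>On each measurable set the iterated series defining \<open>Rbar2\<close> converges
  absolutely, so it is an unordered sum and termwise integration applies.\<close>

lemma signed_integral_Rbar2:
  assumes xy: "x \<in> space M" "y \<in> space M"
  shows "signed_integral (M \<Otimes>\<^sub>M M) (Rbar2 M P \<mu> x y) f = (\<integral>i. T (fst i) (snd i) x y \<partial>C)"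
proof -
  let ?\<nu> = "\<lambda>i. \<nu> (fst i) (snd i) x y"
  let ?a = "\<lambda>i :: nat \<times> nat. add_measure (K (fst i) x \<Otimes>\<^sub>M K (snd i) y) (\<mu> \<Otimes>\<^sub>M \<mu>)"
  let ?b = "\<lambda>i :: nat \<times> nat. add_measure (K (fst i) x \<Otimes>\<^sub>M \<mu>) (\<mu> \<Otimes>\<^sub>M K (snd i) y)"
  have norm: "(\<integral>\<^sup>+i. signed_norm (M \<Otimes>\<^sub>M M) V (?\<nu> i) \<partial>C) < \<infinity>"
    using C2[OF xy] by (auto simp: nn_integral_count_space_prod_nat intro: le_less_trans)
  have s: "sets (?a i) = sets (M \<Otimes>\<^sub>M M)" "sets (?b i) = sets (M \<Otimes>\<^sub>M M)" for i
    using sets_pairs[OF xy] by simp_all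
  have R: "Rbar2 M P \<mu> x y A = (\<integral>i. ?\<nu> i A \<partial>C)" if A: "A \<in> sets (M \<Otimes>\<^sub>M M)" for A
  proof -
    have "integrable C (\<lambda>i. ?\<nu> i A)"
      using integrable_series[of ?a ?b "M \<Otimes>\<^sub>M M" ?\<nu> V A] finite_add_pairs[OF xy] s \<nu>_eq_diff[OF xy]
        V V_ge_1 norm A by blast
    then show ?thesis
      by (simp add: Rbar2_def integral_count_space_prod_nat)
  qed
  have "signed_integral (M \<Otimes>\<^sub>M M) (Rbar2 M P \<mu> x y) f = (\<integral>i. signed_integral (M \<Otimes>\<^sub>M M) (?\<nu> i) f \<partial>C)"
    by (rule signed_integral_series(2)[of ?a ?b "M \<Otimes>\<^sub>M M" ?\<nu> V])
      (use finite_add_pairs[OF xy] s \<nu>_eq_diff[OF xy] V V_ge_1 norm R f f_bound L_nonneg in blast)+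
  then show ?thesis
    by (simp add: signed_integral_\<nu>[OF xy])
qed

section \<open>Symmetry and recursion of the terms of the series\<close>

lemma T_sym:
  assumes xy: "x \<in> space M" "y \<in> space M"
  shows "T n m x y = T m n y x"
proof -
  interpret pair_sigma_finite "K m y" "K n x"
    using xy by (intro pair_sigma_finite_prob prob_K)
  have "T m n y x = (\<integral>(u, v). f (v, u) \<partial>(K n x \<Otimes>\<^sub>M K m y))"
    unfolding T_def using integrable_f[OF xy(2,1)] by (intro integral_product_swap[symmetric]) auto
  also have "\<dots> = T n m x y"
    unfolding T_def using xy
    by (intro Bochner_Integration.integral_cong refl) (auto simp: space_pair_measure space_K f_sym)
  finally show ?thesis ..
qed

lemma T_0:
  assumes xy: "x \<in> space M" "y \<in> space M"
  shows "T 0 0 x y = f (x, y)"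
proof -
  interpret pair_sigma_finite "K 0 x" "K 0 y"
    using xy by (intro pair_sigma_finite_prob prob_K)
  have "T 0 0 x y = (\<integral>u. (\<integral>v. f (u, v) \<partial>K 0 y) \<partial>K 0 x)"
    unfolding T_def using integrable_f(1)[OF xy] by (intro integral_fst'[symmetric])
  also have "\<dots> = (\<integral>u. f (u, y) \<partial>return M x)"
    using xy by (intro Bochner_Integration.integral_cong) (auto intro!: integral_return)
  also have "\<dots> = f (x, y)"
    using xy by (intro integral_return) auto
  finally show ?thesis .
qed

lemma measurable_K_pair:
  assumes "y \<in> space M"
  shows "(\<lambda>z. K n z \<Otimes>\<^sub>M K m y) \<in> M \<rightarrow>\<^sub>M subprob_algebra (M \<Otimes>\<^sub>M M)"
proof -
  have "K m y \<in> space (prob_algebra M)"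
    using measurable_space[OF K assms] .
  then show ?thesis
    by (intro measurable_prob_algebraD measurable_pair_prob K) simp
qed

lemma measurable_T:
  assumes "y \<in> space M"
  shows "(\<lambda>z. T n m z y) \<in> borel_measurable M"
  unfolding T_def
  using measurable_compose[OF measurable_K_pair[OF assms] integral_measurable_subprob_algebra[OF f]] .

text \<open>The recursion of \<open>kernel_power\<close> puts the new step first, so the law after
  \<open>Suc n\<close> steps is the mixture of the laws \<open>K n z\<close> with \<open>z\<close>
  drawn from \<open>P x\<close>; pairing with \<open>K m y\<close> preserves the mixture.\<close>

lemma T_Suc:
  assumes xy: "x \<in> space M" "y \<in> space M"
  shows "T (Suc n) m x y = (\<integral>z. T n m z y \<partial>P x)"
  unfolding T_def
proof (rule integral_mixture(2))
  interpret y: prob_space "K m y"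
    using xy by (intro prob_K)
  show "integrable (K (Suc n) x \<Otimes>\<^sub>M K m y) f"
    using integrable_f(1)[OF xy] .
  show "sets (K n z \<Otimes>\<^sub>M K m y) = sets (K (Suc n) x \<Otimes>\<^sub>M K m y)" if "z \<in> space (P x)" for z
    using that xy by (simp add: sets_pairs space_P del: kernel_power.simps)
  fix g :: "'a \<times> 'a \<Rightarrow> ennreal" assume "g \<in> borel_measurable (K (Suc n) x \<Otimes>\<^sub>M K m y)"
  then have g: "g \<in> borel_measurable (M \<Otimes>\<^sub>M M)"
    unfolding measurable_cong_sets[OF sets_pairs(1)[OF xy] refl] .
  have "(\<lambda>z. \<integral>\<^sup>+p. g p \<partial>(K n z \<Otimes>\<^sub>M K m y)) \<in> borel_measurable M"
    using measurable_compose[OF measurable_K_pair[OF xy(2)] nn_integral_measurable_subprob_algebra[OF g]] .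
  then show "(\<lambda>z. \<integral>\<^sup>+p. g p \<partial>(K n z \<Otimes>\<^sub>M K m y)) \<in> borel_measurable (P x)"
    by (simp add: measurable_cong_sets[OF sets_P[OF xy(1)] refl])
  have g': "(\<lambda>u. \<integral>\<^sup>+v. g (u, v) \<partial>K m y) \<in> borel_measurable M"
    using g by (intro y.borel_measurable_nn_integral)
      (simp add: measurable_cong_sets[OF sets_pair_measure_cong[OF refl sets_K[OF xy(2)]] refl])
  have fst: "(\<integral>\<^sup>+p. g p \<partial>(K k z \<Otimes>\<^sub>M K m y)) = (\<integral>\<^sup>+u. (\<integral>\<^sup>+v. g (u, v) \<partial>K m y) \<partial>K k z)"
    if "z \<in> space M" for k z
    using g by (intro y.nn_integral_fst[symmetric])
      (simp add: measurable_cong_sets[OF sets_pairs(1)[OF that xy(2)] refl] del: kernel_power.simps)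
  have "K n \<in> P x \<rightarrow>\<^sub>M subprob_algebra M"
    using measurable_prob_algebraD[OF K] by (simp add: measurable_cong_sets[OF sets_P[OF xy(1)] refl])
  then have "(\<integral>\<^sup>+u. (\<integral>\<^sup>+v. g (u, v) \<partial>K m y) \<partial>K (Suc n) x) =
      (\<integral>\<^sup>+z. (\<integral>\<^sup>+u. (\<integral>\<^sup>+v. g (u, v) \<partial>K m y) \<partial>K n z) \<partial>P x)"
    using nn_integral_bind[OF g'] by simp
  also have "\<dots> = (\<integral>\<^sup>+z. (\<integral>\<^sup>+p. g p \<partial>(K n z \<Otimes>\<^sub>M K m y)) \<partial>P x)"
    by (intro nn_integral_cong) (simp add: fst space_P[OF xy(1)])
  finally show "(\<integral>\<^sup>+p. g p \<partial>(K (Suc n) x \<Otimes>\<^sub>M K m y)) = (\<integral>\<^sup>+z. (\<integral>\<^sup>+p. g p \<partial>(K n z \<Otimes>\<^sub>M K m y)) \<partial>P x)"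
    using fst[OF xy(1), of "Suc n"] by simp
qed

lemma measurable_T_family:
  assumes "x \<in> space M" "y \<in> space M"
  shows "(\<lambda>(i, z). T (\<alpha> i) (\<beta> i) z y) \<in> borel_measurable (C \<Otimes>\<^sub>M P x)"
  using measurable_T[OF assms(2)]
  by (intro measurable_pair_measure_countable1) (simp_all add: measurable_cong_sets[OF sets_P[OF assms(1)] refl])

lemma pair_sigma_finite_C:
  assumes "x \<in> space M"
  shows "pair_sigma_finite C (P x)"
  using assms by (simp add: pair_sigma_finite_def prob_space_imp_sigma_finite prob_P
      sigma_finite_measure_count_space_countable)

text \<open>Fubini for counting measure and \<open>P x\<close>. The offset \<open>k\<close> is 0
  when \<open>P\<close> acts on one coordinate and 1 when the second coordinate has already been
  averaged.\<close>

lemma integral_P_series: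
  assumes xy: "x \<in> space M" "y \<in> space M"
    and fin: "(\<integral>\<^sup>+z. (\<integral>\<^sup>+i. ennreal \<bar>T (fst i) (snd i + k) z y\<bar> \<partial>C) \<partial>P x) < \<infinity>"
  shows "(\<integral>z. (\<integral>i. T (fst i) (snd i + k) z y \<partial>C) \<partial>P x) = (\<integral>i. T (Suc (fst i)) (snd i + k) x y \<partial>C)"
proof -
  interpret pair_sigma_finite C "P x"
    by (rule pair_sigma_finite_C[OF xy(1)])
  let ?F = "\<lambda>i z. T (fst i) (snd i + k) z y"
  have m [measurable]: "case_prod ?F \<in> borel_measurable (C \<Otimes>\<^sub>M P x)"
    by (rule measurable_T_family[OF xy])
  have "(\<integral>\<^sup>+p. ennreal (norm (case_prod ?F p)) \<partial>(C \<Otimes>\<^sub>M P x)) =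
      (\<integral>\<^sup>+z. (\<integral>\<^sup>+i. ennreal \<bar>?F i z\<bar> \<partial>C) \<partial>P x)"
    by (subst nn_integral_snd[symmetric]) auto
  then have "integrable (C \<Otimes>\<^sub>M P x) (case_prod ?F)"
    using fin by (intro integrableI_bounded m) simp
  then show ?thesis
    unfolding T_Suc[OF xy] by (rule Fubini_integral)
qed

lemma measurable_W:
  assumes "y \<in> space M"
  shows "(\<lambda>z. W (z, y)) \<in> borel_measurable M" "(\<lambda>z. W (y, z)) \<in> borel_measurable M"
  using assms by measurable

text \<open>By symmetry and \<open>T_Suc\<close>, a shift of the second index is an average over
  \<open>P y\<close>; averaging the bound by \<open>W\<close> then yields the domination needed for
  the double step.\<close>

lemma nn_integral_T_shift:
  assumes xy: "x \<in> space M" "y \<in> space M"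
  shows "(\<integral>\<^sup>+i. ennreal \<bar>T (fst i) (snd i + 1) x y\<bar> \<partial>C)
    \<le> ennreal L * (ennreal c * (\<integral>\<^sup>+z. ennreal (W (x, z)) \<partial>P y))"
proof -
  interpret pair_sigma_finite C "P y"
    by (rule pair_sigma_finite_C[OF xy(2)])
  have "(\<integral>\<^sup>+i. ennreal \<bar>T (fst i) (snd i + 1) x y\<bar> \<partial>C) \<le>
      (\<integral>\<^sup>+i. (\<integral>\<^sup>+z. ennreal \<bar>T (snd i) (fst i) z x\<bar> \<partial>P y) \<partial>C)"
    using xy T_sym[OF xy] T_Suc[OF xy(2,1)] by (intro nn_integral_mono) (simp add: ennreal_abs_integral_le)
  also have "\<dots> = (\<integral>\<^sup>+z. (\<integral>\<^sup>+i. ennreal \<bar>T (snd i) (fst i) z x\<bar> \<partial>C) \<partial>P y)"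
    using measurable_T_family[OF xy(2,1), of snd fst]
    by (intro Fubini'[symmetric]) (auto simp: split_beta)
  also have "\<dots> \<le> (\<integral>\<^sup>+z. ennreal L * (ennreal c * ennreal (W (x, z))) \<partial>P y)"
  proof (rule nn_integral_mono)
    fix z assume "z \<in> space (P y)"
    then have z: "z \<in> space M" using xy by (simp add: space_P)
    show "(\<integral>\<^sup>+i. ennreal \<bar>T (snd i) (fst i) z x\<bar> \<partial>C) \<le> ennreal L * (ennreal c * ennreal (W (x, z)))"
      using nn_integral_T[OF xy(1) z] by (simp add: T_sym[OF z xy(1)])
  qed
  also have "\<dots> = ennreal L * (ennreal c * (\<integral>\<^sup>+z. ennreal (W (x, z)) \<partial>P y))"
    using measurable_W(2)[OF xy(1)]
    by (simp add: nn_integral_cmult measurable_cong_sets[OF sets_P[OF xy(2)] refl])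
  finally show ?thesis .
qed

text \<open>For \<open>f = hbar2 \<mu> (h n)\<close> this is
  \<open>Gbar2 M P \<mu> (h n)\<close>.\<close>

definition G :: "'a \<times> 'a \<Rightarrow> real" where
  "G = (\<lambda>(x, y). signed_integral (M \<Otimes>\<^sub>M M) (Rbar2 M P \<mu> x y) f)"

lemma G_eq:
  assumes "x \<in> space M" "y \<in> space M"
  shows "G (x, y) = (\<integral>i. T (fst i) (snd i) x y \<partial>C)"
  using signed_integral_Rbar2[OF assms] by (simp add: G_def)

lemma G_sym:
  assumes xy: "x \<in> space M" "y \<in> space M"
  shows "G (x, y) = G (y, x)"
  unfolding G_eq[OF xy] G_eq[OF xy(2,1)] T_sym[OF xy]
  by (rule integral_count_space_swap)

text \<open>The series for \<open>G (z, y)\<close> is dominated by a multiple of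
  \<open>W (z, y)\<close>, whose average over \<open>P x\<close> is finite at this very pair; this
  allows exchanging the sum with \<open>P\<close>.\<close>

lemma kernel_fst_G:
  assumes xy: "x \<in> space M" "y \<in> space M"
  shows "kernel_fst P G (x, y) = (\<integral>i. T (Suc (fst i)) (snd i) x y \<partial>C)"
proof -
  have "(\<integral>\<^sup>+z. (\<integral>\<^sup>+i. ennreal \<bar>T (fst i) (snd i) z y\<bar> \<partial>C) \<partial>P x) \<le>
      (\<integral>\<^sup>+z. ennreal L * (ennreal c * ennreal (W (z, y))) \<partial>P x)"
    using xy by (intro nn_integral_mono nn_integral_T) (auto simp: space_P)
  also have "\<dots> = ennreal L * (ennreal c * (\<integral>\<^sup>+z. ennreal (W (z, y)) \<partial>P x))"
    using measurable_W(1)[OF xy(2)]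
    by (simp add: nn_integral_cmult measurable_cong_sets[OF sets_P[OF xy(1)] refl])
  also have "\<dots> < \<infinity>"
    using PW[OF xy] by (simp add: ennreal_mult_less_top)
  finally have "(\<integral>z. (\<integral>i. T (fst i) (snd i) z y \<partial>C) \<partial>P x) = (\<integral>i. T (Suc (fst i)) (snd i) x y \<partial>C)"
    using integral_P_series[OF xy, of 0] by simp
  moreover have "kernel_fst P G (x, y) = (\<integral>z. (\<integral>i. T (fst i) (snd i) z y \<partial>C) \<partial>P x)"
    unfolding kernel_fst_def using xy by (auto intro!: Bochner_Integration.integral_cong simp: space_P G_eq)
  ultimately show ?thesis by simp
qed

lemma kernel_fst_G_swap:
  assumes xy: "x \<in> space M" "y \<in> space M"
  shows "kernel_fst P G (y, x) = (\<integral>i. T (fst i) (snd i + 1) x y \<partial>C)"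
  unfolding kernel_fst_G[OF xy(2,1)] T_sym[OF xy(2,1)]
  using integral_count_space_swap[of "\<lambda>n m. T m (Suc n) x y"] by simp

text \<open>Symmetry of \<open>G\<close> turns the inner integral into
  \<open>kernel_fst P G (y, z\<^sub>1)\<close>, a series with shifted second index. The outer
  integral is then the case \<open>k = 1\<close>, dominated through the finite average of
  \<open>W\<close> over both coordinates.\<close>

lemma kernel_both_G:
  assumes xy: "x \<in> space M" "y \<in> space M"
  shows "kernel_both P G (x, y) = (\<integral>i. T (Suc (fst i)) (Suc (snd i)) x y \<partial>C)"
proof -
  have inner: "(\<integral>z\<^sub>2. G (z\<^sub>1, z\<^sub>2) \<partial>P y) = (\<integral>i. T (fst i) (snd i + 1) z\<^sub>1 y \<partial>C)" if z: "z\<^sub>1 \<in> space M" for z\<^sub>1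
  proof -
    have "(\<integral>z\<^sub>2. G (z\<^sub>1, z\<^sub>2) \<partial>P y) = kernel_fst P G (y, z\<^sub>1)"
      unfolding kernel_fst_def using xy z
      by (auto intro!: Bochner_Integration.integral_cong G_sym simp: space_P)
    then show ?thesis
      using kernel_fst_G_swap[OF z xy(2)] by simp
  qed
  interpret Py: prob_space "P y"
    using prob_P[OF xy(2)] .
  have m: "(\<lambda>z. \<integral>\<^sup>+z\<^sub>2. ennreal (W (z, z\<^sub>2)) \<partial>P y) \<in> borel_measurable M"
    using W by (intro Py.borel_measurable_nn_integral)
      (simp add: measurable_cong_sets[OF sets_pair_measure_cong[OF refl sets_P[OF xy(2)]] refl])
  have "(\<integral>\<^sup>+z. (\<integral>\<^sup>+i. ennreal \<bar>T (fst i) (snd i + 1) z y\<bar> \<partial>C) \<partial>P x) \<le>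
      (\<integral>\<^sup>+z. ennreal L * (ennreal c * (\<integral>\<^sup>+z\<^sub>2. ennreal (W (z, z\<^sub>2)) \<partial>P y)) \<partial>P x)"
    using xy by (intro nn_integral_mono nn_integral_T_shift) (auto simp: space_P)
  also have "\<dots> = ennreal L * (ennreal c * (\<integral>\<^sup>+z. (\<integral>\<^sup>+z\<^sub>2. ennreal (W (z, z\<^sub>2)) \<partial>P y) \<partial>P x))"
    using m by (simp add: nn_integral_cmult measurable_cong_sets[OF sets_P[OF xy(1)] refl])
  also have "\<dots> < \<infinity>"
    using PPW[OF xy] by (simp add: ennreal_mult_less_top)
  finally have "(\<integral>z. (\<integral>i. T (fst i) (snd i + 1) z y \<partial>C) \<partial>P x) = (\<integral>i. T (Suc (fst i)) (snd i + 1) x y \<partial>C)"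
    by (rule integral_P_series[OF xy])
  moreover have "kernel_both P G (x, y) = (\<integral>z. (\<integral>i. T (fst i) (snd i + 1) z y \<partial>C) \<partial>P x)"
    unfolding kernel_both_def using xy by (auto intro!: Bochner_Integration.integral_cong simp: space_P inner)
  ultimately show ?thesis by simp
qed

text \<open>\<open>Qterm\<close> takes the arguments in the order \<open>j - 1\<close>,
  \<open>l - 1\<close>, while \<open>zeta_term\<close> takes them in the opposite order.\<close>

lemma kernel_both_G_sym:
  assumes xy: "x \<in> space M" "y \<in> space M"
  shows "kernel_both P G (x, y) = kernel_both P G (y, x)"
  unfolding kernel_both_G[OF xy] kernel_both_G[OF xy(2,1)] T_sym[OF xy]
  using integral_count_space_swap[of "\<lambda>n m. T (Suc m) (Suc n) y x"] .

lemma poisson_equation: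
  assumes xy: "x \<in> space M" "y \<in> space M"
  shows "f (x, y) = G (x, y) - kernel_fst P G (x, y) - kernel_fst P G (y, x) + kernel_both P G (x, y)"
  using double_series_inclusion_exclusion[OF integrable_T[OF xy]]
  by (simp add: T_0[OF xy] G_eq[OF xy] kernel_fst_G[OF xy] kernel_fst_G_swap[OF xy] kernel_both_G[OF xy])

end

section \<open>The second-order projection satisfies the assumptions on \<open>f\<close>\<close>

lemma nn_integral_pair_real_integrable:
  fixes h :: "'a \<times> 'b \<Rightarrow> real"
  assumes "sigma_finite_measure N" "h \<in> borel_measurable (M \<Otimes>\<^sub>M N)"
    and "(\<integral>\<^sup>+x. (\<integral>\<^sup>+y. ennreal \<bar>h (x, y)\<bar> \<partial>N) \<partial>M) < \<infinity>"
  shows "integrable (M \<Otimes>\<^sub>M N) h"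
  using assms sigma_finite_measure.nn_integral_fst[OF assms(1), of "\<lambda>p. ennreal \<bar>h p\<bar>" M]
  by (simp add: integrable_iff_bounded)

lemma hbar2_symmetric:
  assumes "symmetric_on S h" "x \<in> S" "y \<in> S"
  shows "hbar2 \<mu> h (x, y) = hbar2 \<mu> h (y, x)"
  using assms by (simp add: hbar2_def symmetric_on_def)

lemma weighted_space_bound:
  assumes "f \<in> weighted_space N V" "\<And>p. p \<in> space N \<Longrightarrow> 0 < V p"
  obtains L where "0 \<le> L" "\<And>p. p \<in> space N \<Longrightarrow> \<bar>f p\<bar> \<le> L * V p"
proof -
  define L where "L = enn2real (weighted_norm N V f)"
  have L: "weighted_norm N V f = ennreal L"
    using assms(1) by (simp add: weighted_space_def L_def less_top)
  have "\<bar>f p\<bar> \<le> L * V p" if p: "p \<in> space N" for p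
  proof -
    have "ennreal (\<bar>f p\<bar> / V p) \<le> ennreal L"
      unfolding L[symmetric] weighted_norm_def using p by (rule SUP_upper)
    then have "\<bar>f p\<bar> / V p \<le> L"
      by (simp add: L_def)
    then show ?thesis
      using assms(2)[OF p] by (simp add: pos_divide_le_eq)
  qed
  then show thesis
    by (intro that[of L]) (auto simp: L_def)
qed

text \<open>
  Fubini only makes \<open>h (x, \<cdot>)\<close> integrable for almost every \<open>x\<close>, and the integral in \<open>hbar1\<close> is \<open>0\<close>
  for the others. The weighted bound on \<open>hbar2\<close> excludes such exceptional points.
\<close>

lemma (in centered_kernel) hbar2_degenerate:
  assumes h [measurable]: "h \<in> borel_measurable (M \<Otimes>\<^sub>M M)"
    and int: "(\<integral>\<^sup>+x. (\<integral>\<^sup>+y. ennreal \<bar>h (x, y)\<bar> \<partial>\<mu>) \<partial>\<mu>) < \<infinity>"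
    and L: "0 \<le> L" "\<And>p. p \<in> space (M \<Otimes>\<^sub>M M) \<Longrightarrow> \<bar>hbar2 \<mu> h p\<bar> \<le> L * V p"
    and hbar2: "hbar2 \<mu> h \<in> borel_measurable (M \<Otimes>\<^sub>M M)"
    and x: "x \<in> space M"
  shows "(\<integral>y. hbar2 \<mu> h (x, y) \<partial>\<mu>) = 0"
proof -
  interpret \<mu>: prob_space \<mu>
    by (rule prob_\<mu>)
  interpret pair_sigma_finite \<mu> \<mu>
    by (intro pair_sigma_finite.intro \<mu>.sigma_finite_measure)
  have sp: "space \<mu> = space M"
    using sets_\<mu> by (rule sets_eq_imp_space_eq)
  have "integrable (\<mu> \<Otimes>\<^sub>M \<mu>) h"
    using h int by (intro nn_integral_pair_real_integrable \<mu>.sigma_finite_measure)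
      (simp_all add: measurable_cong_sets[OF sets_pairs(4)[OF x x] refl])
  then have "integrable \<mu> (\<lambda>y. \<integral>z. h (y, z) \<partial>\<mu>)"
    by (rule integrable_fst')
  then have b: "integrable \<mu> (hbar1 \<mu> h)" "(\<integral>y. hbar1 \<mu> h y \<partial>\<mu>) = 0"
    unfolding hbar1_def[abs_def] by (simp_all add: theta_def \<mu>.prob_space)
  have Vx: "(\<lambda>y. V (x, y)) \<in> borel_measurable \<mu>" and fx: "(\<lambda>y. hbar2 \<mu> h (x, y)) \<in> borel_measurable \<mu>"
    using V hbar2 x unfolding measurable_cong_sets[OF sets_\<mu> refl] by measurable
  \<comment> \<open>As \<open>K 0 x\<close> is a Dirac measure, the case \<open>n = 0\<close> of
    \<open>V_finite\<close> says that \<open>V (x, \<cdot>)\<close> is \<mu>-integrable for every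
    \<open>x\<close>.\<close>
  have "(\<integral>\<^sup>+p. ennreal (V p) \<partial>(K 0 x \<Otimes>\<^sub>M \<mu>)) = (\<integral>\<^sup>+u. (\<integral>\<^sup>+y. ennreal (V (u, y)) \<partial>\<mu>) \<partial>K 0 x)"
    using V by (intro \<mu>.nn_integral_fst[symmetric])
      (simp add: measurable_cong_sets[OF sets_pairs(2)[OF x x] refl] del: kernel_power.simps)
  also have "\<dots> = (\<integral>\<^sup>+y. ennreal (V (x, y)) \<partial>\<mu>)"
    using x V unfolding kernel_power.simps
    by (intro nn_integral_return \<mu>.borel_measurable_nn_integral)
      (simp_all add: measurable_cong_sets[OF sets_pair_measure_cong[OF refl sets_\<mu>] refl] split_beta')
  finally have "(\<integral>\<^sup>+y. ennreal (V (x, y)) \<partial>\<mu>) < \<infinity>"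
    using V_finite(2)[OF x x, of 0] by simp
  then have i: "integrable \<mu> (\<lambda>y. hbar2 \<mu> h (x, y))"
    using x L sp by (intro integrable_weight_bound[OF fx Vx]) (auto simp: space_pair_measure)
  \<comment> \<open>Solved for \<open>h\<close>, this writes \<open>h (x, \<cdot>)\<close> as a sum
    of integrable functions, so the integral in \<open>hbar1\<close> is a genuine one at each
    \<open>x\<close>. Integrating the identity then gives the claim.\<close>
  have eq: "h (x, y) = hbar2 \<mu> h (x, y) + hbar1 \<mu> h x + hbar1 \<mu> h y + theta \<mu> h" for y
    by (simp add: hbar2_def)
  have "(\<integral>y. h (x, y) \<partial>\<mu>) = (\<integral>y. hbar2 \<mu> h (x, y) \<partial>\<mu>) + hbar1 \<mu> h x + theta \<mu> h"
    unfolding eq using i b by (simp add: \<mu>.prob_space)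
  then show ?thesis
    by (simp add: hbar1_def)
qed

section \<open>Summation by parts\<close>

lemma sum_shift_pred:
  fixes g :: "nat \<Rightarrow> real"
  shows "(\<Sum>j=1..Suc l. g (j - 1)) = g 0 + (\<Sum>j=1..l. g j)"
  by (induction l) auto

text \<open>Here \<open>A\<close> stands for the one-step and \<open>B\<close> for the two-step
  average of the potential along the path. Abel summation in \<open>l\<close> produces
  \<open>varpi1\<close>, in \<open>j\<close> it produces \<open>varpi2\<close> and the two boundary
  terms in \<open>A\<close>. The \<open>B\<close> terms balance because
  \<open>varpi3 - varpi1 - varpi2\<close> at \<open>(Suc l, j)\<close> is
  \<open>w l (j - 1) - w (Suc l) j\<close>. The row length \<open>k\<close> is independent of
  \<open>l\<close> so that induction on it applies.\<close>

lemma row_summation_by_parts: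
  fixes A B w :: "nat \<Rightarrow> nat \<Rightarrow> real"
  shows "(\<Sum>j=1..k. w (Suc l) j * (A l j - A (Suc l) j + A (j - 1) (Suc l) - A j (Suc l)
      + B (Suc l) j - B l (j - 1))) =
    (\<Sum>j=1..k. varpi1 w (Suc l) j * (A l j - B l (j - 1)))
    + (\<Sum>j=1..k. varpi2 w (Suc l) j * (A (j - 1) (Suc l) - B l (j - 1)))
    + (\<Sum>j=1..k. varpi3 w (Suc l) j * B l (j - 1))
    + w (Suc l) 0 * A 0 (Suc l) - w (Suc l) k * A k (Suc l)
    + (\<Sum>j=1..k. w (Suc l) j * (B (Suc l) j - A (Suc l) j))
    + (\<Sum>j=1..k. w l j * A l j) - (\<Sum>j=1..k. w l (j - 1) * B l (j - 1))"
  by (induction k) (simp_all add: varpi1_def varpi2_def varpi3_def algebra_simps)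

text \<open>Passing from \<open>n\<close> to \<open>Suc n\<close> adds one row cut at its diagonal.
  The sum over the last row in \<open>eps_term\<close> is a boundary term that the next row cancels.
  That row also reaches one entry past the diagonal of row \<open>n\<close>, which is the origin of
  the weights \<open>w (l - 1) l\<close>.\<close>

lemma zeta_term_eq:
  assumes sym: "\<And>i j. kernel_both P G (x i, x j) = kernel_both P G (x j, x i)"
  shows "zeta_term P n w G x = (\<Sum>l=1..n. \<Sum>j=1..l. w l j *
    (kernel_fst P G (x (l - 1), x j) - kernel_fst P G (x l, x j)
      + kernel_fst P G (x (j - 1), x l) - kernel_fst P G (x j, x l)
      + kernel_both P G (x l, x j) - kernel_both P G (x (l - 1), x (j - 1))))"
proof (induction n)
  case 0
  then show ?case
    by (simp add: zeta_term_def eps_term_def)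
next
  case (Suc n)
  define A where "A i j = kernel_fst P G (x i, x j)" for i j
  define B where "B i j = kernel_both P G (x i, x j)" for i j
  \<comment> \<open>The shifted row ends in \<open>B n 0\<close>, whereas \<open>eps_term\<close>
    contains the two-step average at \<open>x 0\<close> and \<open>x n\<close>; this is where
    symmetry enters.\<close>
  have B: "B n 0 = B 0 n"
    by (simp add: B_def sym)
  have "zeta_term P (Suc n) w G x - zeta_term P n w G x =
      (\<Sum>j=1..Suc n. w (Suc n) j * (A n j - A (Suc n) j + A (j - 1) (Suc n) - A j (Suc n)
        + B (Suc n) j - B n (j - 1)))"
    unfolding row_summation_by_parts sum_shift_pred[of "\<lambda>j. w n j * B n j"] B
    unfolding zeta_term_def eps_term_def A_def[symmetric] B_def[symmetric]
    by (simp add: sum_subtractf right_diff_distrib)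
  with Suc.IH show ?case
    by (simp add: A_def B_def)
qed

text \<open>An index occurs once as a row and once as a column, so interchanging the sums collects
  both occurrences; the diagonal weight is rightly counted twice.\<close>

lemma sum_w1:
  fixes b :: "nat \<Rightarrow> real"
  shows "(\<Sum>l=1..n. w1 n w l * b l) = (\<Sum>l=1..n. \<Sum>j=1..l. w l j * (b l + b j))"
proof -
  have "(\<Sum>l=1..n. (\<Sum>j=l..n. w j l) * b l) = (\<Sum>l=1..n. \<Sum>j=1..l. w l j * b j)"
  proof (induction n)
    case (Suc n)
    have "(\<Sum>l=1..n. (\<Sum>j=l..Suc n. w j l) * b l) = (\<Sum>l=1..n. (\<Sum>j=l..n. w j l) * b l + w (Suc n) l * b l)"
      by (intro sum.cong) (auto simp: distrib_right)
    with Suc show ?case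
      by (simp add: sum.distrib)
  qed simp
  then show ?thesis
    by (simp add: w1_def distrib_left distrib_right sum.distrib sum_distrib_right)
qed

lemma U_stat_decomposition:
  assumes poisson: "\<And>i j. hbar2 \<mu> h (x i, x j) = G (x i, x j) - kernel_fst P G (x i, x j)
      - kernel_fst P G (x j, x i) + kernel_both P G (x i, x j)"
    and G_sym: "\<And>i j. G (x i, x j) = G (x j, x i)"
    and both_sym: "\<And>i j. kernel_both P G (x i, x j) = kernel_both P G (x j, x i)"
  shows "U_stat n w h x = U0 \<mu> n w h
    + (\<Sum>l=1..n. w1 n w l * hbar1 \<mu> h (x l) + w l l * Qterm P G x l l)
    + (\<Sum>l=1..n. \<Sum>j=1..l-1. w l j * Qterm P G x l j) + zeta_term P n w G x"
proof -
  have Q: "(\<Sum>l=1..n. \<Sum>j=1..l. w l j * Qterm P G x l j) =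
      (\<Sum>l=1..n. w l l * Qterm P G x l l) + (\<Sum>l=1..n. \<Sum>j=1..l-1. w l j * Qterm P G x l j)"
    unfolding sum.distrib[symmetric]
  proof (rule sum.cong)
    fix l assume "l \<in> {1..n}"
    then show "(\<Sum>j=1..l. w l j * Qterm P G x l j) =
        w l l * Qterm P G x l l + (\<Sum>j=1..l-1. w l j * Qterm P G x l j)"
      by (cases l) auto
  qed simp
  \<comment> \<open>\<open>Qterm\<close> lags one index in each one-step average and both in the
    two-step average. Replacing the unlagged averages of the Poisson equation by these leaves
    exactly the summand of \<open>zeta_term_eq\<close>.\<close>
  have h: "h (x l, x j) = theta \<mu> h + (hbar1 \<mu> h (x l) + hbar1 \<mu> h (x j)) + Qterm P G x l j
      + (kernel_fst P G (x (l - 1), x j) - kernel_fst P G (x l, x j)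
      + kernel_fst P G (x (j - 1), x l) - kernel_fst P G (x j, x l)
      + kernel_both P G (x l, x j) - kernel_both P G (x (l - 1), x (j - 1)))" for l j
    using poisson[of l j] G_sym[of l j] both_sym[of "l - 1" "j - 1"]
    by (simp add: hbar2_def Qterm_def)
  have "U_stat n w h x = U0 \<mu> n w h + (\<Sum>l=1..n. w1 n w l * hbar1 \<mu> h (x l))
      + (\<Sum>l=1..n. \<Sum>j=1..l. w l j * Qterm P G x l j) + zeta_term P n w G x"
    unfolding U_stat_def U0_def sum_w1 zeta_term_eq[OF both_sym] h
    by (simp only: distrib_left[of "w _ _"] sum.distrib sum_distrib_left mult.commute[of "theta \<mu> h"])
  then show ?thesis
    unfolding Q by (simp add: sum.distrib)
qed

theorem lemma2p2:
  fixes M :: "'a measure" and P :: "'a \<Rightarrow> 'a measure" and \<mu> :: "'a measure"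
    and \<Omega> :: "'w measure" and X :: "nat \<Rightarrow> 'w \<Rightarrow> 'a"
    and V W :: "'a \<times> 'a \<Rightarrow> real"
    and h :: "nat \<Rightarrow> 'a \<times> 'a \<Rightarrow> real"
    and w :: "nat \<Rightarrow> nat \<Rightarrow> nat \<Rightarrow> real"
  assumes "countably_generated M"
    and "markov_kernel M P"
    and "invariant_distribution M P \<mu>"
    and "markov_chain \<Omega> M P X"
    and "V \<in> borel_measurable (M \<Otimes>\<^sub>M M)" and "W \<in> borel_measurable (M \<Otimes>\<^sub>M M)"
    and "symmetric_on (space M) V" and "symmetric_on (space M) W"
    and "\<And>x y. x \<in> space M \<Longrightarrow> y \<in> space M \<Longrightarrow> 1 \<le> V (x, y) \<and> V (x, y) \<le> W (x, y)"
    and "cond_C2 M P \<mu> V W"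
    and "\<And>x y. x \<in> space M \<Longrightarrow> y \<in> space M \<Longrightarrow>
           (\<integral>\<^sup>+z. ennreal (W (z, y)) \<partial>P x) < \<infinity>"
    and "\<And>x y. x \<in> space M \<Longrightarrow> y \<in> space M \<Longrightarrow>
           (\<integral>\<^sup>+z\<^sub>1. (\<integral>\<^sup>+z\<^sub>2. ennreal (W (z\<^sub>1, z\<^sub>2)) \<partial>P y) \<partial>P x) < \<infinity>"
    and "\<And>n. 1 \<le> n \<Longrightarrow> h n \<in> borel_measurable (M \<Otimes>\<^sub>M M)"
    and "\<And>n. 1 \<le> n \<Longrightarrow> symmetric_on (space M) (h n)"
    and "\<And>n. 1 \<le> n \<Longrightarrow> (\<integral>\<^sup>+x. (\<integral>\<^sup>+y. ennreal \<bar>h n (x, y)\<bar> \<partial>\<mu>) \<partial>\<mu>) < \<infinity>"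
    and "\<And>n. 1 \<le> n \<Longrightarrow> hbar2 \<mu> (h n) \<in> weighted_space (M \<Otimes>\<^sub>M M) V"
  shows "\<forall>n\<ge>1. \<forall>\<omega>\<in>space \<Omega>.
    (let x = (\<lambda>k. X k \<omega>); G = Gbar2 M P \<mu> (h n) in
      U_stat n (w n) (h n) x =
        U0 \<mu> n (w n) (h n)
        + (\<Sum>l=1..n. w1 n (w n) l * hbar1 \<mu> (h n) (x l) + w n l l * Qterm P G x l l)
        + (\<Sum>l=1..n. \<Sum>j=1..l-1. w n l j * Qterm P G x l j)
        + zeta_term P n (w n) G x)"
proof (intro allI impI ballI)
  fix n :: nat and \<omega> assume n: "1 \<le> n" and \<omega>: "\<omega> \<in> space \<Omega>"
  \<comment> \<open>From here on the trajectory is a fixed sequence of points of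
    \<open>space M\<close>, and all identities are applied at these points.\<close>
  have X: "X k \<omega> \<in> space M" for k
    using assms(4) \<omega> by (auto simp: markov_chain_def dest: measurable_space)
  have V1: "1 \<le> V p" if "p \<in> space (M \<Otimes>\<^sub>M M)" for p
    using that assms(9) by (auto simp: space_pair_measure)
  obtain c where c: "\<And>x y. x \<in> space M \<Longrightarrow> y \<in> space M \<Longrightarrow> (\<Sum>n. \<Sum>m. signed_norm (M \<Otimes>\<^sub>M M) V
      (signed_prod M (centered_power M P \<mu> n x) (centered_power M P \<mu> m y))) \<le> ennreal (c * W (x, y))"
    using assms(10) unfolding cond_C2_def by blast
  \<comment> \<open>The constant of C2 may be negative, while factoring it out of
    \<open>ennreal\<close> products requires a nonnegative one. Since \<open>W\<close> is positive,
    enlarging it to \<open>max 0 c\<close> preserves the bound.\<close>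
  have c_max: "(\<Sum>n. \<Sum>m. signed_norm (M \<Otimes>\<^sub>M M) V
      (signed_prod M (centered_power M P \<mu> n x) (centered_power M P \<mu> m y))) \<le> ennreal (max 0 c * W (x, y))"
    if xy: "x \<in> space M" "y \<in> space M" for x y
  proof -
    have "c * W (x, y) \<le> max 0 c * W (x, y)"
      using assms(9)[OF xy] by (intro mult_right_mono) auto
    then show ?thesis
      using c[OF xy] by (blast intro: order_trans ennreal_leI)
  qed
  have hbar2_meas: "hbar2 \<mu> (h n) \<in> borel_measurable (M \<Otimes>\<^sub>M M)"
    using assms(16)[OF n] by (simp add: weighted_space_def)
  obtain L where L: "0 \<le> L" "\<And>p. p \<in> space (M \<Otimes>\<^sub>M M) \<Longrightarrow> \<bar>hbar2 \<mu> (h n) p\<bar> \<le> L * V p"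
    using weighted_space_bound[OF assms(16)[OF n]] V1 by (metis less_le_trans zero_less_one)
  interpret centered_kernel M P \<mu> V W "max 0 c"
    using assms(2,3,5) V1 c_max
    by unfold_locales (simp_all add: markov_kernel_def invariant_distribution_def)
  interpret degenerate_function M P \<mu> V W "max 0 c" "hbar2 \<mu> (h n)" L
  proof
    show "hbar2 \<mu> (h n) (x, y) = hbar2 \<mu> (h n) (y, x)" if "x \<in> space M" "y \<in> space M" for x y
      using hbar2_symmetric[OF assms(14)[OF n] that] .
    show "(\<integral>y. hbar2 \<mu> (h n) (x, y) \<partial>\<mu>) = 0" if "x \<in> space M" for x
      using hbar2_degenerate[OF assms(13)[OF n] assms(15)[OF n] L hbar2_meas that] .
    show "W (x, y) = W (y, x)" if "x \<in> space M" "y \<in> space M" for x y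
      using assms(8) that by (simp add: symmetric_on_def)
  qed (use assms(6,11,12) L hbar2_meas in auto)
  have G: "Gbar2 M P \<mu> (h n) = G"
    by (simp add: Gbar2_def G_def)
  show "let x = (\<lambda>k. X k \<omega>); G = Gbar2 M P \<mu> (h n) in
      U_stat n (w n) (h n) x =
        U0 \<mu> n (w n) (h n)
        + (\<Sum>l=1..n. w1 n (w n) l * hbar1 \<mu> (h n) (x l) + w n l l * Qterm P G x l l)
        + (\<Sum>l=1..n. \<Sum>j=1..l-1. w n l j * Qterm P G x l j)
        + zeta_term P n (w n) G x"
    unfolding Let_def G
    by (intro U_stat_decomposition poisson_equation G_sym kernel_both_G_sym X)
qed

end
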